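(* Let $G$ be a group and let $L,N$ be normal subgroups of $G$ with $L\geqslant N$. Assume $\mathcal{W}(G,L,N)$ is nonzero and finite dimensional, $\ell=\dim_{\mathbb{R}}\mathcal{W}(G,L,N)$. Take any basis of $\mathcal{W}(G,L,N)$ and representatives $\nu_1,\dots,\nu_\ell\in\mathrm{Q}(N)^G$, and define $\Phi^{\mathbb{R}}\colon[G,N]\to\mathbb{R}^\ell$ by $\Phi^{\mathbb{R}}(y)=(\nu_1(y),\dots,\nu_\ell(y))$. Then: (1) $\Phi^{\mathbb{R}}\colon([G,N],d_{\mathrm{scl}_{G,N}})\to(\mathbb{R}^\ell,\|\cdot\|_1)$ is a pre-coarse homomorphism; (2) for all $y_1,y_2\in[G,N]$, $\|\Phi^{\mathbb{R}}(y_1)-\Phi^{\mathbb{R}}(y_2)\|_1\le 2\big(\sum_j\mathscr{D}(\nu_j)\big)d_{\mathrm{scl}_{G,N}}(y_1,y_2)+\sum_j\mathscr{D}(\nu_j)$; (3) there exist constants $\mathscr{C}_1,\mathscr{C}_2>0$ depending only on $(\nu_1,\dots,\nu_\ell)$ such that for every $d_{\mathrm{scl}_{G,L}}$-bounded set $A\subseteq[G,N]$, with $D_A$ its $d_{\mathrm{scl}_{G,L}}$-diameter, and all $y_1,y_2\in A$, $$\|\Phi^{\mathbb{R}}(y_1)-\Phi^{\mathbb{R}}(y_2)\|_1\ge\frac{2}{\mathscr{C}_1\mathscr{C}_2}d_{\mathrm{scl}_{G,N}}(y_1,y_2)-\frac{(2D_A+1)\mathscr{C}_1+1}{\mathscr{C}_1\mathscr{C}_2}.$$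 In particular $\Phi^{\mathbb{R}}$ is a coarse homomorphism and its restriction to every $d_{\mathrm{scl}_{G,L}}$-bounded set is a quasi-isometric embedding.
   Context: $[G,N]$ is generated by $[g,x]=gxg^{-1}x^{-1}$ ($g\in G,x\in N$); $\mathrm{cl}_{G,N}$ word length w.r.t. these; $\mathrm{scl}_{G,N}(y)=\lim_n\mathrm{cl}_{G,N}(y^n)/n$; $d_{\mathrm{scl}_{G,N}}(y_1,y_2)=\mathrm{scl}_{G,N}(y_1^{-1}y_2)$, and $d_{\mathrm{scl}_{G,L}}$ defined likewise on $[G,N]\subseteq[G,L]$. Defect $\mathscr{D}(\psi)=\sup|\psi(h_1h_2)-\psi(h_1)-\psi(h_2)|$. $\mathrm{Q}(N)^G$: homogeneous quasimorphisms on $N$ invariant under $G$-conjugation; $\mathrm{H}^1(N)^G$: $G$-invariant homomorphisms; $\mathcal{W}(G,L,N)=\mathrm{Q}(N)^G/(\mathrm{H}^1(N)^G+\{\psi|_N:\psi\in\mathrm{Q}(L)^G\})$. Pre-coarse homomorphism: $\sup\|\Phi(yy')-\Phi(y)-\Phi(y')\|<\infty$; coarse homomorphism: controlled pre-coarse homomorphism; quasi-isometric embedding: $C_1d-D_1\le d'\le C_2d+D_2$. *)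

theory Defs
  imports Complex_Main
begin

text \<open>The ambient group G is the (possibly non-abelian) group type 'g, written additively
  (class group_add): g + x is the product, -g the inverse, 0 the identity.\<close>

definition normal_subgroup :: "'g::group_add set \<Rightarrow> bool" where
  "normal_subgroup N \<longleftrightarrow> 0 \<in> N \<and> (\<forall>a\<in>N. \<forall>b\<in>N. a + b \<in> N) \<and> (\<forall>a\<in>N. - a \<in> N)
     \<and> (\<forall>g. \<forall>a\<in>N. g + a - g \<in> N)"

definition commutator :: "'g::group_add \<Rightarrow> 'g \<Rightarrow> 'g" where
  "commutator g x = g + x - g - x"

definition comm_gens :: "'g::group_add set \<Rightarrow> 'g set" where
  "comm_gens N = {commutator g x | g x. x \<in> N} \<union> {- commutator g x | g x. x \<in> N}"

definition mixed_comm :: "'g::group_add set \<Rightarrow> 'g set" where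
  "mixed_comm N = {sum_list xs | xs. set xs \<subseteq> comm_gens N}"

definition cl :: "'g::group_add set \<Rightarrow> 'g \<Rightarrow> nat" where
  "cl N y = (LEAST n. \<exists>xs. length xs = n \<and> set xs \<subseteq> comm_gens N \<and> sum_list xs = y)"

definition gpow :: "'g::group_add \<Rightarrow> nat \<Rightarrow> 'g" where
  "gpow y n = sum_list (replicate n y)"

definition scl :: "'g::group_add set \<Rightarrow> 'g \<Rightarrow> real" where
  "scl N y = lim (\<lambda>n. real (cl N (gpow y n)) / real n)"

definition d_scl :: "'g::group_add set \<Rightarrow> 'g \<Rightarrow> 'g \<Rightarrow> real" where
  "d_scl N y1 y2 = scl N (- y1 + y2)"

definition defect :: "'g::group_add set \<Rightarrow> ('g \<Rightarrow> real) \<Rightarrow> real" where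
  "defect N \<psi> = Sup {\<bar>\<psi> (h1 + h2) - \<psi> h1 - \<psi> h2\<bar> | h1 h2. h1 \<in> N \<and> h2 \<in> N}"

text \<open>Functions on N are represented as functions on 'g vanishing outside N.\<close>

definition hom_qm :: "'g::group_add set \<Rightarrow> ('g \<Rightarrow> real) set" where
  "hom_qm N = {\<psi>. (\<forall>x. x \<notin> N \<longrightarrow> \<psi> x = 0)
      \<and> (\<exists>D. \<forall>a\<in>N. \<forall>b\<in>N. \<bar>\<psi> (a + b) - \<psi> a - \<psi> b\<bar> \<le> D)
      \<and> (\<forall>a\<in>N. \<forall>n. \<psi> (gpow a n) = real n * \<psi> a)
      \<and> (\<forall>a\<in>N. \<psi> (- a) = - \<psi> a)}"

definition inv_hom_qm :: "'g::group_add set \<Rightarrow> ('g \<Rightarrow> real) set" where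
  "inv_hom_qm N = {\<psi> \<in> hom_qm N. \<forall>g. \<forall>x\<in>N. \<psi> (g + x - g) = \<psi> x}"

definition inv_hom :: "'g::group_add set \<Rightarrow> ('g \<Rightarrow> real) set" where
  "inv_hom N = {\<psi>. (\<forall>x. x \<notin> N \<longrightarrow> \<psi> x = 0)
      \<and> (\<forall>a\<in>N. \<forall>b\<in>N. \<psi> (a + b) = \<psi> a + \<psi> b)
      \<and> (\<forall>g. \<forall>x\<in>N. \<psi> (g + x - g) = \<psi> x)}"

definition W_denominator :: "'g::group_add set \<Rightarrow> 'g set \<Rightarrow> ('g \<Rightarrow> real) set" where
  "W_denominator L N = {\<lambda>x. h x + (if x \<in> N then \<psi> x else 0) | h \<psi>.
      h \<in> inv_hom N \<and> \<psi> \<in> inv_hom_qm L}"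

definition lin_comb :: "nat \<Rightarrow> (nat \<Rightarrow> real) \<Rightarrow> (nat \<Rightarrow> 'g \<Rightarrow> real) \<Rightarrow> 'g \<Rightarrow> real" where
  "lin_comb l c \<nu> = (\<lambda>x. \<Sum>j<l. c j * \<nu> j x)"

text \<open>nu_0,...,nu_(l-1) in Q(N)^G are representatives of a basis of
  W(G,L,N) = Q(N)^G / W_denominator L N (so dim W = l).\<close>
definition W_basis_reps :: "'g::group_add set \<Rightarrow> 'g set \<Rightarrow> nat \<Rightarrow> (nat \<Rightarrow> 'g \<Rightarrow> real) \<Rightarrow> bool" where
  "W_basis_reps L N l \<nu> \<longleftrightarrow>
     (\<forall>j<l. \<nu> j \<in> inv_hom_qm N)
     \<and> (\<forall>c. lin_comb l c \<nu> \<in> W_denominator L N \<longrightarrow> (\<forall>j<l. c j = 0))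
     \<and> (\<forall>\<psi>\<in>inv_hom_qm N. \<exists>c. \<exists>s\<in>W_denominator L N. \<psi> = (\<lambda>x. lin_comb l c \<nu> x + s x))"

definition Phi_dist :: "nat \<Rightarrow> (nat \<Rightarrow> 'g \<Rightarrow> real) \<Rightarrow> 'g \<Rightarrow> 'g \<Rightarrow> real" where
  "Phi_dist l \<nu> y1 y2 = (\<Sum>j<l. \<bar>\<nu> j y1 - \<nu> j y2\<bar>)"

definition d_bounded :: "('g \<Rightarrow> 'g \<Rightarrow> real) \<Rightarrow> 'g set \<Rightarrow> bool" where
  "d_bounded d A \<longleftrightarrow> (\<exists>B. \<forall>a\<in>A. \<forall>b\<in>A. d a b \<le> B)"

definition d_diam :: "('g \<Rightarrow> 'g \<Rightarrow> real) \<Rightarrow> 'g set \<Rightarrow> real" where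
  "d_diam d A = Sup {d a b | a b. a \<in> A \<and> b \<in> A}"

end

theory Submission
  imports Defs "HOL-Library.Function_Algebras"
begin

text \<open>
  Everything reduces to a linear bound \<open>scl N y \<le> C * ((\<Sum>j<l. \<bar>\<nu> j y\<bar>) + scl L y)\<close> on \<open>[G,N]\<close>. Every
  \<open>\<psi> \<in> Q(N)\<^sup>G\<close> is on \<open>[G,N]\<close> a combination of the \<open>\<nu> j\<close> and of an invariant quasimorphism on \<open>L\<close>, hence
  bounded there by a multiple, depending on \<open>\<psi>\<close>, of the right-hand side. A gliding hump makes the
  multiple uniform over defect at most 1, and a weak form of Bavard duality for mixed commutators
  (each \<open>y \<in> [G,N]\<close> has a \<open>\<psi>\<close> of defect at most 1 with \<open>\<psi> y \<ge> scl N y\<close>) turns this into the bound for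
  \<open>scl N\<close>. Duality is a Hahn-Banach argument on the group of integral chains in \<open>N\<close>, where
  a chain \<open>\<Sum> \<epsilon>\<^sub>i x\<^sub>i\<close> is measured by the growth rate in \<open>m\<close> of the commutator length of the product of the
  \<open>x\<^sub>i\<close> to the powers \<open>\<epsilon>\<^sub>i m\<close>. The same extension principle applied to real sequences gives a limit
  functional, which supplies the completeness needed for the gliding hump.
\<close>

section \<open>Hahn-Banach for abelian groups\<close>

text \<open>\<open>S\<close> plays the role of the epigraph of a partially defined sublinear functional. Of the ring \<open>'a\<close> only
  the additive group matters; multiplication merely provides the multiples \<open>of_nat k * z\<close>.\<close>
lemma additive_majorized_exists:
  fixes S :: "('a::ring_1 \<times> real) set"
  assumes zero: "(0, 0) \<in> S"
    and add: "\<And>c d s t. (c, s) \<in> S \<Longrightarrow> (d, t) \<in> S \<Longrightarrow> (c + d, s + t) \<in> S"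
    and sym: "\<And>c s. (c, s) \<in> S \<Longrightarrow> \<exists>t. (- c, t) \<in> S"
    and pos: "\<And>s. (0, s) \<in> S \<Longrightarrow> 0 \<le> s"
  obtains F where "\<And>c d. F (c + d) = F c + F d" "\<And>c s. (c, s) \<in> S \<Longrightarrow> F c \<le> s"
proof -
  \<comment> \<open>Partial solutions are subgroups of \<open>'a \<times> real\<close>, closure
    under differences being the subgroup condition. That they are graphs of functions follows from
    majorization at \<open>(0, 0) \<in> S\<close>, as in \<open>unique\<close> below.\<close>
  define \<G> where "\<G> = {A :: ('a \<times> real) set. (0, 0) \<in> A
    \<and> (\<forall>c r d q. (c, r) \<in> A \<longrightarrow> (d, q) \<in> A \<longrightarrow> (c - d, r - q) \<in> A)
    \<and> (\<forall>c r s. (c, r) \<in> A \<longrightarrow> (c, s) \<in> S \<longrightarrow> r \<le> s)}"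
  have "{(0, 0)} \<in> \<G>"
    using pos by (simp add: \<G>_def)
  then have "\<G> \<noteq> {}" by blast
  moreover have "\<Union>C \<in> \<G>" if "C \<noteq> {}" "subset.chain \<G> C" for C
  proof -
    have C: "A \<in> \<G>" if "A \<in> C" for A
      using that \<open>subset.chain \<G> C\<close> by (auto simp: subset.chain_def)
    have "(c - d, r - q) \<in> \<Union>C" if cd: "(c, r) \<in> A" "(d, q) \<in> B" "A \<in> C" "B \<in> C" for c d r q A B
    proof -
      have "A \<subseteq> B \<or> B \<subseteq> A"
        using \<open>subset.chain \<G> C\<close> cd(3,4) unfolding subset.chain_def by blast
      then obtain D where D: "D \<in> C" "A \<subseteq> D" "B \<subseteq> D"
        using cd by blast
      then have "(c - d, r - q) \<in> D"
        using C[OF D(1)] cd unfolding \<G>_def by blast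
      then show ?thesis using D by blast
    qed
    moreover have "(0, 0) \<in> \<Union>C"
      using \<open>C \<noteq> {}\<close> C unfolding \<G>_def by blast
    moreover have "r \<le> s" if "(c, r) \<in> A" "A \<in> C" "(c, s) \<in> S" for c r s A
      using C[OF that(2)] that unfolding \<G>_def by blast
    ultimately show ?thesis
      unfolding \<G>_def by (intro CollectI conjI allI impI) (blast intro: UnionI)+
  qed
  ultimately obtain M where M: "M \<in> \<G>" and max: "\<And>X. X \<in> \<G> \<Longrightarrow> M \<subseteq> X \<Longrightarrow> X = M"
    using subset_Zorn_nonempty[of \<G>] by metis
  have M0: "(0, 0) \<in> M" and Mdiff: "\<And>c r d q. (c, r) \<in> M \<Longrightarrow> (d, q) \<in> M \<Longrightarrow> (c - d, r - q) \<in> M"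
    and MS: "\<And>c r s. (c, r) \<in> M \<Longrightarrow> (c, s) \<in> S \<Longrightarrow> r \<le> s"
    using M unfolding \<G>_def by blast+
  have Muminus: "(- c, - r) \<in> M" if "(c, r) \<in> M" for c r
    using Mdiff[OF M0 that] by simp
  have Madd: "(c + d, r + q) \<in> M" if "(c, r) \<in> M" "(d, q) \<in> M" for c r d q
    using Mdiff[OF that(1) Muminus[OF that(2)]] by simp
  have Mmult: "(of_nat n * c, of_nat n * r) \<in> M" if "(c, r) \<in> M" for c r n
    by (induction n) (use M0 Madd[OF that] in \<open>auto simp: distrib_right\<close>)
  have Smult: "(of_nat n * c, of_nat n * r) \<in> S" if "(c, r) \<in> S" for c r n
    by (induction n) (use zero add[OF that] in \<open>auto simp: distrib_right\<close>)
  have total: "\<exists>a. (z, a) \<in> M" for z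
  proof -
    \<comment> \<open>A value \<open>a\<close> at \<open>z\<close> must satisfy
      \<open>r + k * a \<le> s\<close> for every bound on \<open>h + k * z\<close> and
      \<open>r - k * a \<le> s\<close> for every bound on \<open>h - k * z\<close>. \<open>U\<close>
      and \<open>V\<close> collect the resulting upper and lower bounds for
      \<open>a\<close>.\<close>
    define U where "U = {(s - r) / real k | h r s k. (h, r) \<in> M \<and> 0 < k \<and> (h + of_nat k * z, s) \<in> S}"
    define V where "V = {(r - s) / real k | h r s k. (h, r) \<in> M \<and> 0 < k \<and> (h - of_nat k * z, s) \<in> S}"
    have VU: "v \<le> u" if uv: "v \<in> V" "u \<in> U" for u v
    proof -
      obtain h r s k where 1: "u = (s - r) / real k" "(h, r) \<in> M" "0 < k" "(h + of_nat k * z, s) \<in> S"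
        using uv(2) unfolding U_def by blast
      obtain h' r' s' j where 2: "v = (r' - s') / real j" "(h', r') \<in> M" "0 < j" "(h' - of_nat j * z, s') \<in> S"
        using uv(1) unfolding V_def by blast
      \<comment> \<open>Adding \<open>j\<close> copies of the first relation and \<open>k\<close>
        copies of the second cancels \<open>z\<close>, so majorization on \<open>M\<close> compares
        the two bounds.\<close>
      have "(of_nat j * h + of_nat k * h', of_nat j * r + of_nat k * r') \<in> M"
        by (intro Madd Mmult 1 2)
      moreover have "of_nat j * (of_nat k * z) = of_nat k * (of_nat j * z)"
        by (metis mult.assoc mult_of_nat_commute)
      then have "of_nat j * (h + of_nat k * z) + of_nat k * (h' - of_nat j * z) = of_nat j * h + of_nat k * h'"
        by (simp add: distrib_left right_diff_distrib)
      then have "(of_nat j * h + of_nat k * h', of_nat j * s + of_nat k * s') \<in> S"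
        using add[OF Smult[OF 1(4), of j] Smult[OF 2(4), of k]] by simp
      ultimately have "of_nat j * r + of_nat k * r' \<le> of_nat j * s + of_nat k * s'"
        by (rule MS)
      then have "(r' - s') * real k \<le> (s - r) * real j"
        by (simp add: algebra_simps)
      then show ?thesis
        using 1(1,3) 2(1,3) by (simp add: divide_le_eq pos_le_divide_eq mult.commute)
    qed
    \<comment> \<open>By \<open>sym\<close> the sets \<open>U\<close> and \<open>V\<close> are empty
      together. If both are empty, any \<open>a\<close> will do; otherwise \<open>Inf U\<close>
      separates them.\<close>
    have "V \<noteq> {}" if "U \<noteq> {}"
    proof -
      obtain h r s k where "(h, r) \<in> M" "0 < k" "(h + of_nat k * z, s) \<in> S"
        using \<open>U \<noteq> {}\<close> unfolding U_def by blast
      moreover from this obtain t where "(- h - of_nat k * z, t) \<in> S"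
        using sym[of "h + of_nat k * z"] by auto
      ultimately have "(- r - t) / real k \<in> V"
        unfolding V_def using Muminus by blast
      then show ?thesis by blast
    qed
    moreover have "U \<noteq> {}" if "V \<noteq> {}"
    proof -
      obtain h r s k where "(h, r) \<in> M" "0 < k" "(h - of_nat k * z, s) \<in> S"
        using \<open>V \<noteq> {}\<close> unfolding V_def by blast
      moreover from this obtain t where "(- h + of_nat k * z, t) \<in> S"
        using sym[of "h - of_nat k * z"] by auto
      ultimately have "(t - - r) / real k \<in> U"
        unfolding U_def using Muminus by blast
      then show ?thesis by blast
    qed
    moreover have "(\<forall>v\<in>V. v \<le> Inf U) \<and> (\<forall>u\<in>U. Inf U \<le> u)" if "U \<noteq> {}" "V \<noteq> {}"
    proof -
      have "bdd_below U" using VU that by (meson bdd_below.I ex_in_conv)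
      then show ?thesis using that VU by (meson cInf_greatest cInf_lower)
    qed
    ultimately obtain a where aV: "\<And>v. v \<in> V \<Longrightarrow> v \<le> a" and aU: "\<And>u. u \<in> U \<Longrightarrow> a \<le> u"
      by blast
    \<comment> \<open>The subgroup generated by \<open>M\<close> and \<open>(z, a)\<close>;
      maximality will put \<open>(z, a)\<close> into \<open>M\<close> itself.\<close>
    define X where "X = {(h + of_int k * z, r + of_int k * a) | h r k. (h, r) \<in> M}"
    have "X \<in> \<G>"
      unfolding \<G>_def
    proof (intro CollectI conjI allI impI)
      show "(0, 0) \<in> X"
        using M0 unfolding X_def by (intro CollectI exI[of _ 0]) auto
      show "(c - d, r - q) \<in> X" if "(c, r) \<in> X" "(d, q) \<in> X" for c r d q
      proof -
        obtain h p k h' p' k' where "(h, p) \<in> M" "c = h + of_int k * z" "r = p + of_int k * a"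
          "(h', p') \<in> M" "d = h' + of_int k' * z" "q = p' + of_int k' * a"
          using \<open>(c, r) \<in> X\<close> \<open>(d, q) \<in> X\<close> unfolding X_def by blast
        then show ?thesis
          unfolding X_def
          by (intro CollectI exI[of _ "h - h'"] exI[of _ "p - p'"] exI[of _ "k - k'"])
             (auto simp: Mdiff algebra_simps)
      qed
      show "r \<le> s" if "(c, r) \<in> X" "(c, s) \<in> S" for c r s
      proof -
        obtain h p k where h: "(h, p) \<in> M" "c = h + of_int k * z" "r = p + of_int k * a"
          using \<open>(c, r) \<in> X\<close> unfolding X_def by blast
        consider "k = 0" | n where "0 < n" "k = int n" | n where "0 < n" "k = - int n"
          by (metis int_cases3 of_nat_0_less_iff)
        then show ?thesis
        proof cases
          case 1
          then show ?thesis using MS h that(2) by simp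
        next
          case 2
          then have "(s - p) / real n \<in> U"
            using h that(2) unfolding U_def by auto
          from aU[OF this] show ?thesis using 2 h by (simp add: field_simps)
        next
          case 3
          then have "(p - s) / real n \<in> V"
            using h that(2) unfolding V_def by auto
          from aV[OF this] show ?thesis using 3 h by (simp add: field_simps)
        qed
      qed
    qed
    moreover have "M \<subseteq> X"
    proof
      fix p assume "p \<in> M"
      then show "p \<in> X"
        unfolding X_def by (cases p) (rule CollectI, rule exI, rule exI, rule exI[of _ 0], simp)
    qed
    moreover have "(z, a) \<in> X"
      using M0 unfolding X_def by (intro CollectI exI[of _ 0] exI[of _ 1]) auto
    ultimately show ?thesis
      using max by blast
  qed
  have unique: "r = q" if "(c, r) \<in> M" "(c, q) \<in> M" for c r q
    using MS[OF Mdiff[OF that], of 0] MS[OF Mdiff[OF that(2,1)], of 0] zero by simp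
  obtain F where F: "\<And>c. (c, F c) \<in> M"
    using total by metis
  show thesis
  proof
    show "F (c + d) = F c + F d" for c d
      by (rule unique[OF F Madd[OF F F]])
    show "F c \<le> s" if "(c, s) \<in> S" for c s
      using MS[OF F that] .
  qed
qed

section \<open>Stable mixed commutator length\<close>

text \<open>Fekete's lemma. Divide \<open>n\<close> by an index \<open>k\<close> whose ratio nearly
  attains the infimum; the remainder, being less than \<open>k\<close>, adds only a bounded amount.
  The infimum starts at 1 because division by zero yields 0.\<close>

lemma subadditive_ratio_tendsto_INF:
  fixes a :: "nat \<Rightarrow> real"
  assumes sub: "\<And>m n. a (m + n) \<le> a m + a n" and nonneg: "\<And>n. 0 \<le> a n"
  shows "(\<lambda>n. a n / real n) \<longlonglongrightarrow> (INF n\<in>{1..}. a n / real n)" (is "_ \<longlonglongrightarrow> ?c")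
proof -
  define c where "c = ?c"
  have bdd: "bdd_below ((\<lambda>n. a n / real n) ` {1..})"
    using nonneg by (intro bdd_belowI[of _ 0]) auto
  have mult: "a (q * n) \<le> real q * a n" if "0 < q" for q n
    using that
  proof (induction q rule: nat_induct_non_zero)
    case (Suc q)
    then show ?case using sub[of n "q * n"] by (simp add: algebra_simps)
  qed simp
  have "(\<lambda>n. a n / real n) \<longlonglongrightarrow> c"
  proof (rule LIMSEQ_I)
    fix e :: real assume "0 < e"
    have "\<exists>x\<in>(\<lambda>n. a n / real n) ` {1..}. x < c + e / 2"
      unfolding c_def using \<open>0 < e\<close> by (intro cInf_lessD) auto
    then obtain k where k: "1 \<le> k" "a k / real k < c + e / 2"
      by auto
    define B where "B = (\<Sum>r<k. a r) + a k"
    have B: "a r \<le> B" if "r < k" for r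
      unfolding B_def using that nonneg by (intro add_increasing2 member_le_sum) auto
    obtain n0 where n0: "real n0 > 2 * B / e" using reals_Archimedean2 by blast
    have "\<bar>a n / real n - c\<bar> < e" if n: "n \<ge> max n0 (max k 1)" for n
    proof -
      have "0 < n div k" using k n by (simp add: div_greater_zero_iff)
      have "a n = a ((n div k) * k + n mod k)" by simp
      also have "\<dots> \<le> a ((n div k) * k) + a (n mod k)" by (rule sub)
      also have "\<dots> \<le> real (n div k) * a k + B"
        using mult[OF \<open>0 < n div k\<close>, of k] B[of "n mod k"] k by (intro add_mono) auto
      also have "real (n div k) * a k \<le> real n / real k * a k"
        using nonneg by (intro mult_right_mono of_nat_div_le_of_nat)
      finally have "a n / real n \<le> (real n / real k * a k + B) / real n"
        by (intro divide_right_mono) auto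
      also have "\<dots> = a k / real k + B / real n"
        using n by (simp add: field_simps)
      also have "B / real n < e / 2"
      proof -
        have "2 * B / e < real n" using n n0 by linarith
        then show ?thesis using \<open>0 < e\<close> n by (simp add: field_simps)
      qed
      finally have "a n / real n < c + e" using k by simp
      moreover have "c \<le> a n / real n"
        unfolding c_def using n by (intro cINF_lower bdd) auto
      ultimately show ?thesis by simp
    qed
    then show "\<exists>n0. \<forall>n\<ge>n0. norm (a n / real n - c) < e"
      unfolding real_norm_def by blast
  qed
  then show ?thesis by (simp add: c_def)
qed

text \<open>Normal form for noncommutative words: differences expanded, inverses pushed inwards,
  brackets to the right. It is used with \<open>add_uminus_conv_diff\<close> deleted, which would
  undo the expansion.\<close>

lemmas group_word_simps = diff_conv_add_uminus minus_add add.assoc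

lemma uminus_sum_list: "- sum_list xs = sum_list (rev (map uminus xs))"
  for xs :: "'g::group_add list"
  by (induction xs) (simp_all add: minus_add)

section \<open>Powers in a noncommutative group written additively\<close>

lemma gpow_0 [simp]: "gpow y 0 = 0"
  by (simp add: gpow_def)

lemma gpow_Suc: "gpow y (Suc n) = y + gpow y n"
  by (simp add: gpow_def)

lemma gpow_add: "gpow y (m + n) = gpow y m + gpow y n"
  by (simp add: gpow_def replicate_add)

lemma gpow_Suc2: "gpow y (Suc n) = gpow y n + y"
  using gpow_add[of y n 1] by (simp add: gpow_Suc)

lemma gpow_uminus: "gpow (- y) n = - gpow y n"
proof (induction n)
  case (Suc n)
  then show ?case
    by (subst gpow_Suc, subst gpow_Suc2) (simp only: minus_add)
qed simp

lemma gpow_gpow: "gpow (gpow y m) n = gpow y (m * n)"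
  by (induction n) (simp_all add: gpow_Suc gpow_add)

lemma gpow_conj: "gpow (g + y - g) n = g + gpow y n - g"
  by (induction n) (simp_all add: gpow_Suc group_word_simps del: add_uminus_conv_diff)

section \<open>The mixed commutator subgroup, its word length and the stable length\<close>

lemma comm_gens_uminus: "s \<in> comm_gens N \<Longrightarrow> - s \<in> comm_gens N"
  unfolding comm_gens_def by force

lemma mixed_comm_0 [simp]: "0 \<in> mixed_comm N"
  unfolding mixed_comm_def by (auto intro!: exI[of _ "[]"])

lemma mixed_comm_add: "a \<in> mixed_comm N \<Longrightarrow> b \<in> mixed_comm N \<Longrightarrow> a + b \<in> mixed_comm N"
proof -
  assume "a \<in> mixed_comm N" "b \<in> mixed_comm N"
  then obtain xs ys where "a = sum_list xs" "set xs \<subseteq> comm_gens N" "b = sum_list ys" "set ys \<subseteq> comm_gens N"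
    unfolding mixed_comm_def by blast
  then show ?thesis
    unfolding mixed_comm_def by (intro CollectI exI[of _ "xs @ ys"]) auto
qed

lemma mixed_comm_uminus: "a \<in> mixed_comm N \<Longrightarrow> - a \<in> mixed_comm N"
  unfolding mixed_comm_def by (force simp: uminus_sum_list intro: comm_gens_uminus)

lemma mixed_comm_gpow: "a \<in> mixed_comm N \<Longrightarrow> gpow a n \<in> mixed_comm N"
  by (induction n) (simp_all add: gpow_Suc mixed_comm_add)

lemma comm_gens_subset_mixed_comm: "comm_gens N \<subseteq> mixed_comm N"
proof
  fix s assume "s \<in> comm_gens N"
  then show "s \<in> mixed_comm N"
    unfolding mixed_comm_def by (intro CollectI exI[of _ "[s]"]) auto
qed

lemma mixed_comm_mono: "N \<subseteq> L \<Longrightarrow> mixed_comm N \<subseteq> mixed_comm L"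
  unfolding mixed_comm_def comm_gens_def by blast

lemma cl_le: "set xs \<subseteq> comm_gens N \<Longrightarrow> cl N (sum_list xs) \<le> length xs"
  unfolding cl_def by (rule Least_le) blast

lemma cl_attained:
  assumes "y \<in> mixed_comm N"
  obtains xs where "length xs = cl N y" "set xs \<subseteq> comm_gens N" "sum_list xs = y"
proof -
  have "\<exists>n xs. length xs = n \<and> set xs \<subseteq> comm_gens N \<and> sum_list xs = y"
    using assms unfolding mixed_comm_def by blast
  then have "\<exists>xs. length xs = cl N y \<and> set xs \<subseteq> comm_gens N \<and> sum_list xs = y"
    unfolding cl_def by (rule LeastI_ex)
  then show thesis using that by blast
qed

lemma cl_0 [simp]: "cl N 0 = 0"
  using cl_le[of "[]" N] by simp

lemma cl_comm_gens: "s \<in> comm_gens N \<Longrightarrow> cl N s \<le> 1"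
  using cl_le[of "[s]" N] by simp

lemma cl_add:
  assumes "a \<in> mixed_comm N" "b \<in> mixed_comm N"
  shows "cl N (a + b) \<le> cl N a + cl N b"
proof -
  obtain xs where "length xs = cl N a" "set xs \<subseteq> comm_gens N" "sum_list xs = a"
    using cl_attained[OF assms(1)] .
  moreover obtain ys where "length ys = cl N b" "set ys \<subseteq> comm_gens N" "sum_list ys = b"
    using cl_attained[OF assms(2)] .
  ultimately show ?thesis
    using cl_le[of "xs @ ys" N] by simp
qed

lemma cl_uminus: "a \<in> mixed_comm N \<Longrightarrow> cl N (- a) \<le> cl N a"
proof -
  assume "a \<in> mixed_comm N"
  then obtain xs where "length xs = cl N a" "set xs \<subseteq> comm_gens N" "sum_list xs = a"
    by (rule cl_attained)
  then show ?thesis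
    using cl_le[of "rev (map uminus xs)" N] comm_gens_uminus by (fastforce simp: uminus_sum_list)
qed

lemma cl_gpow: "a \<in> mixed_comm N \<Longrightarrow> cl N (gpow a n) \<le> n * cl N a"
proof (induction n)
  case (Suc n)
  then show ?case
    using cl_add[of a N "gpow a n"] by (simp add: gpow_Suc mixed_comm_gpow)
qed simp

text \<open>\<open>scl\<close> is defined through \<open>lim\<close>, so convergence has to come
  first: the lengths of powers are subadditive and Fekete's lemma applies. Its limit is an infimum,
  whence the bound valid for each single power.\<close>

lemma
  assumes "y \<in> mixed_comm N"
  shows scl_tendsto: "(\<lambda>n. real (cl N (gpow y n)) / real n) \<longlonglongrightarrow> scl N y"
    and scl_nonneg: "0 \<le> scl N y"
    and scl_mult_le: "real n * scl N y \<le> real (cl N (gpow y n))"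
proof -
  let ?a = "\<lambda>n. real (cl N (gpow y n))"
  have "real (cl N (gpow y (m + n))) \<le> real (cl N (gpow y m)) + real (cl N (gpow y n))" for m n
    using cl_add[of "gpow y m" N "gpow y n"] assms by (simp add: gpow_add mixed_comm_gpow)
  then have lim: "(\<lambda>n. ?a n / real n) \<longlonglongrightarrow> (INF n\<in>{1..}. ?a n / real n)"
    by (intro subadditive_ratio_tendsto_INF) auto
  then have scl: "scl N y = (INF n\<in>{1..}. ?a n / real n)"
    unfolding scl_def by (rule limI)
  show "(\<lambda>n. ?a n / real n) \<longlonglongrightarrow> scl N y"
    using lim scl by simp
  then show "0 \<le> scl N y"
    by (rule LIMSEQ_le_const) auto
  show "real n * scl N y \<le> ?a n"
  proof (cases "n = 0")
    case False
    have "bdd_below ((\<lambda>n. ?a n / real n) ` {1..})"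
      by (intro bdd_belowI[of _ 0]) auto
    then have "scl N y \<le> ?a n / real n"
      unfolding scl using False by (intro cINF_lower) auto
    then show ?thesis
      using False by (simp add: field_simps)
  qed simp
qed

section \<open>Homogeneous quasimorphisms and normal subgroups\<close>

lemma hom_qm_le_defect:
  assumes "\<psi> \<in> hom_qm N" "a \<in> N" "b \<in> N"
  shows "\<bar>\<psi> (a + b) - \<psi> a - \<psi> b\<bar> \<le> defect N \<psi>"
proof -
  obtain D where D: "\<forall>a\<in>N. \<forall>b\<in>N. \<bar>\<psi> (a + b) - \<psi> a - \<psi> b\<bar> \<le> D"
    using assms(1) unfolding hom_qm_def by blast
  show ?thesis
    unfolding defect_def
    by (rule cSup_upper) (use assms D in \<open>auto intro!: bdd_aboveI[of _ D]\<close>)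
qed

lemma inv_hom_qm_add_scaled:
  assumes "\<psi> \<in> inv_hom_qm N" "\<phi> \<in> inv_hom_qm N"
  shows "(\<lambda>x. \<psi> x + c * \<phi> x) \<in> inv_hom_qm N"
proof -
  obtain D where D: "\<forall>a\<in>N. \<forall>b\<in>N. \<bar>\<psi> (a + b) - \<psi> a - \<psi> b\<bar> \<le> D"
    using assms(1) unfolding inv_hom_qm_def hom_qm_def by blast
  obtain E where E: "\<forall>a\<in>N. \<forall>b\<in>N. \<bar>\<phi> (a + b) - \<phi> a - \<phi> b\<bar> \<le> E"
    using assms(2) unfolding inv_hom_qm_def hom_qm_def by blast
  have "\<bar>\<psi> (a + b) + c * \<phi> (a + b) - (\<psi> a + c * \<phi> a) - (\<psi> b + c * \<phi> b)\<bar> \<le> D + \<bar>c\<bar> * E"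
    if "a \<in> N" "b \<in> N" for a b
  proof -
    have "\<psi> (a + b) + c * \<phi> (a + b) - (\<psi> a + c * \<phi> a) - (\<psi> b + c * \<phi> b)
        = (\<psi> (a + b) - \<psi> a - \<psi> b) + c * (\<phi> (a + b) - \<phi> a - \<phi> b)"
      by (simp add: algebra_simps)
    also have "\<bar>\<dots>\<bar> \<le> \<bar>\<psi> (a + b) - \<psi> a - \<psi> b\<bar> + \<bar>c\<bar> * \<bar>\<phi> (a + b) - \<phi> a - \<phi> b\<bar>"
      using abs_triangle_ineq abs_mult by metis
    also have "\<dots> \<le> D + \<bar>c\<bar> * E"
      using D E that by (intro add_mono mult_left_mono) auto
    finally show ?thesis .
  qed
  then show ?thesis
    using assms unfolding inv_hom_qm_def hom_qm_def by (auto simp: algebra_simps)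
qed

locale normal =
  fixes N :: "'g::group_add set"
  assumes normal: "normal_subgroup N"
begin

lemma zero_mem: "0 \<in> N"
  and add_mem: "a \<in> N \<Longrightarrow> b \<in> N \<Longrightarrow> a + b \<in> N"
  and uminus_mem: "a \<in> N \<Longrightarrow> - a \<in> N"
  and conj_mem: "a \<in> N \<Longrightarrow> g + a - g \<in> N"
  using normal unfolding normal_subgroup_def by blast+

lemma gpow_mem: "a \<in> N \<Longrightarrow> gpow a n \<in> N"
  by (induction n) (auto simp: gpow_Suc zero_mem add_mem)

text \<open>The generators are closed under inversion, so either entry of the commutator may be the
  one taken from \<open>N\<close>.\<close>

lemma commutator_mem_comm_gens:
  "x \<in> N \<Longrightarrow> g + x - g - x \<in> comm_gens N"
  "x \<in> N \<Longrightarrow> x + g - x - g \<in> comm_gens N"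
proof -
  assume "x \<in> N"
  then show "g + x - g - x \<in> comm_gens N"
    unfolding comm_gens_def commutator_def by blast
  from comm_gens_uminus[OF this] show "x + g - x - g \<in> comm_gens N"
    by (simp add: group_word_simps del: add_uminus_conv_diff)
qed

lemma comm_gens_subset: "comm_gens N \<subseteq> N"
proof -
  have "g + x - g - x \<in> N" if "x \<in> N" for g x
    using add_mem[OF conj_mem uminus_mem] that by simp
  then show ?thesis
    using uminus_mem unfolding comm_gens_def commutator_def by blast
qed

lemma mixed_comm_subset: "mixed_comm N \<subseteq> N"
proof -
  have "sum_list xs \<in> N" if "set xs \<subseteq> comm_gens N" for xs
    using that comm_gens_subset by (induction xs) (auto simp: zero_mem intro!: add_mem)
  then show ?thesis unfolding mixed_comm_def by blast
qed

lemma comm_gens_conj: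
  assumes "s \<in> comm_gens N"
  shows "h + s - h \<in> comm_gens N"
proof -
  have "h + commutator g x - h = commutator (h + g - h) (h + x - h)" for g x
    by (simp add: commutator_def group_word_simps del: add_uminus_conv_diff)
  moreover have "h + - commutator g x - h = - commutator (h + g - h) (h + x - h)" for g x
    by (simp add: commutator_def group_word_simps del: add_uminus_conv_diff)
  ultimately show ?thesis
    using assms conj_mem unfolding comm_gens_def by blast
qed

text \<open>The easy half of Bavard duality: each generator in a word costs \<open>D\<close> for its
  value and \<open>D\<close> for its multiplication; homogeneity then allows dividing by the
  exponent. \<open>D\<close> is any defect bound, so that 1 can be inserted later.\<close>

lemma abs_le_defect_scl:
  assumes \<psi>: "\<psi> \<in> inv_hom_qm N"
    and D: "\<And>a b. a \<in> N \<Longrightarrow> b \<in> N \<Longrightarrow> \<bar>\<psi> (a + b) - \<psi> a - \<psi> b\<bar> \<le> D"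
    and y: "y \<in> mixed_comm N"
  shows "\<bar>\<psi> y\<bar> \<le> 2 * D * scl N y"
proof -
  have inv: "\<psi> (g + x - g) = \<psi> x" and minus: "\<psi> (- x) = - \<psi> x"
    and pow: "\<psi> (gpow x n) = real n * \<psi> x" if "x \<in> N" for g x n
    using \<psi> that unfolding inv_hom_qm_def hom_qm_def by auto
  \<comment> \<open>By invariance and oddness the values at the factors \<open>g + x - g\<close> and
    \<open>- x\<close> cancel, leaving only the defect.\<close>
  have comm: "\<bar>\<psi> (g + x - g - x)\<bar> \<le> D" if "x \<in> N" for g x
    using D[OF conj_mem uminus_mem, OF that that, of g] inv minus that by simp
  have gen: "\<bar>\<psi> s\<bar> \<le> D" if s: "s \<in> comm_gens N" for s
  proof -
    from s consider g x where "x \<in> N" "s = g + x - g - x" | g x where "x \<in> N" "s = - (g + x - g - x)"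
      unfolding comm_gens_def commutator_def by blast
    then show ?thesis
    proof cases
      case 2
      have "g + x - g - x \<in> N"
        using comm_gens_subset commutator_mem_comm_gens(1) 2(1) by blast
      then show ?thesis
        using comm[OF 2(1)] unfolding 2(2) minus[OF \<open>g + x - g - x \<in> N\<close>] abs_minus_cancel by blast
    qed (use comm in simp)
  qed
  have sum: "\<bar>\<psi> (sum_list xs)\<bar> \<le> 2 * D * length xs" if "set xs \<subseteq> comm_gens N" for xs
    using that
  proof (induction xs)
    case Nil
    then show ?case using pow[OF zero_mem, of 0] by simp
  next
    case (Cons s xs)
    have "sum_list xs \<in> N" "s \<in> N"
      using Cons.prems mixed_comm_subset comm_gens_subset unfolding mixed_comm_def by auto
    then have "\<bar>\<psi> (s + sum_list xs) - \<psi> s - \<psi> (sum_list xs)\<bar> \<le> D"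
      using D by blast
    then show ?case
      using Cons gen[of s] by (simp add: algebra_simps)
  qed
  have "\<bar>\<psi> y\<bar> \<le> 2 * D * (real (cl N (gpow y n)) / real n)" if "0 < n" for n
  proof -
    obtain xs where "length xs = cl N (gpow y n)" "set xs \<subseteq> comm_gens N" "sum_list xs = gpow y n"
      using cl_attained[OF mixed_comm_gpow[OF y]] .
    then have "\<bar>\<psi> (gpow y n)\<bar> \<le> 2 * D * real (cl N (gpow y n))"
      using sum[of xs] by simp
    then show ?thesis
      using pow[of y n] y mixed_comm_subset that by (auto simp: field_simps abs_mult)
  qed
  then have "\<forall>\<^sub>F n in sequentially. \<bar>\<psi> y\<bar> \<le> 2 * D * (real (cl N (gpow y n)) / real n)"
    by (intro eventually_mono[OF eventually_gt_at_top[of 0]])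
  then show ?thesis
    using tendsto_lowerbound[OF tendsto_mult_left[OF scl_tendsto[OF y]]] by simp
qed

end

section \<open>Bavard duality up to a constant\<close>

text \<open>An integral chain is presented by an ordered list of elements, \<open>True\<close>
  standing for coefficient 1 and \<open>False\<close> for -1. The order matters for the product of
  the powers with common exponent \<open>m\<close>; \<open>chain_coef\<close> forgets it and gives
  the element of the free abelian group.\<close>

definition signed_gpow :: "nat \<Rightarrow> bool \<times> 'g::group_add \<Rightarrow> 'g" where
  "signed_gpow m p = (if fst p then gpow (snd p) m else - gpow (snd p) m)"

definition chain_prod :: "nat \<Rightarrow> (bool \<times> 'g::group_add) list \<Rightarrow> 'g" where
  "chain_prod m ws = sum_list (map (signed_gpow m) ws)"

definition chain_coef :: "(bool \<times> 'g) list \<Rightarrow> 'g \<Rightarrow> int" where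
  "chain_coef ws = (\<lambda>x. int (count_list ws (True, x)) - int (count_list ws (False, x)))"

lemma chain_prod_append: "chain_prod m (us @ vs) = chain_prod m us + chain_prod m vs"
  by (simp add: chain_prod_def)

lemma chain_prod_Cons: "chain_prod m (p # ws) = signed_gpow m p + chain_prod m ws"
  by (simp add: chain_prod_def)

lemma chain_prod_Nil [simp]: "chain_prod m [] = 0"
  by (simp add: chain_prod_def)

lemma chain_coef_append: "chain_coef (us @ vs) = chain_coef us + chain_coef vs"
  by (simp add: chain_coef_def fun_eq_iff)

lemma chain_coef_Nil [simp]: "chain_coef [] = 0"
  by (simp add: chain_coef_def fun_eq_iff)

lemma chain_coef_Cons: "chain_coef (p # ws) = chain_coef [p] + chain_coef ws"
  using chain_coef_append[of "[p]" ws] by simp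

lemma chain_coef_flip: "chain_coef [(\<not> b, x)] = - chain_coef [(b, x)]"
  by (cases b) (simp_all add: chain_coef_def fun_eq_iff)

context normal
begin

text \<open>The epigraph of the growth rate in \<open>m\<close> of the commutator length of the
  product. The constant \<open>K\<close> absorbs the bounded cost of rearranging a word.\<close>

definition chain_bounds :: "(('g \<Rightarrow> int) \<times> real) set" where
  "chain_bounds = {(chain_coef ws, s) | ws s. snd ` set ws \<subseteq> N \<and>
     (\<exists>K. \<forall>m. chain_prod m ws \<in> mixed_comm N \<and> real (cl N (chain_prod m ws)) \<le> K + s * real m)}"

lemma chain_boundsI:
  assumes "snd ` set ws \<subseteq> N" "\<And>m. chain_prod m ws \<in> mixed_comm N"
    and "\<And>m. real (cl N (chain_prod m ws)) \<le> K + s * real m"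
  shows "(chain_coef ws, s) \<in> chain_bounds"
  using assms unfolding chain_bounds_def by blast

text \<open>If the coefficients vanish, an entry \<open>p\<close> is cancelled by a later entry, and
  \<open>p + U - p = commutator p U + U\<close>: each cancellation costs one generator, whatever the
  exponent \<open>m\<close> is.\<close>
lemma chain_coef_eq_0:
  assumes "snd ` set ws \<subseteq> N" "chain_coef ws = 0"
  shows "chain_prod m ws \<in> mixed_comm N \<and> cl N (chain_prod m ws) \<le> length ws"
  using assms
proof (induction ws rule: length_induct)
  case (1 ws)
  show ?case
  proof (cases ws)
    case (Cons p vs)
    obtain b x where p: "p = (b, x)" by (cases p)
    have "chain_coef ws x = 0"
      using "1.prems" by simp
    then have "count_list vs (\<not> b, x) \<noteq> 0"
      unfolding Cons p chain_coef_def by (cases b) auto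
    then have "(\<not> b, x) \<in> set vs"
      by (metis count_list_0_iff)
    then obtain us ts where vs: "vs = us @ (\<not> b, x) # ts"
      using split_list by metis
    let ?p = "signed_gpow m p" and ?u = "chain_prod m us"
    have "chain_coef (us @ ts) = 0"
      using "1.prems"(2) unfolding Cons vs p chain_coef_append
      by (subst (asm) chain_coef_Cons, subst (asm) chain_coef_append, subst (asm) chain_coef_Cons)
         (simp add: chain_coef_append chain_coef_flip)
    moreover have "length (us @ ts) < length ws" "snd ` set (us @ ts) \<subseteq> N"
      using "1.prems"(1) unfolding Cons vs by auto
    ultimately have IH: "chain_prod m (us @ ts) \<in> mixed_comm N"
      "cl N (chain_prod m (us @ ts)) \<le> length (us @ ts)"
      using "1.IH" by blast+
    have "?p \<in> N"
      using "1.prems"(1) unfolding Cons p by (auto simp: signed_gpow_def intro!: gpow_mem uminus_mem)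
    then have gen: "?p + ?u - ?p - ?u \<in> comm_gens N"
      by (rule commutator_mem_comm_gens)
    have "signed_gpow m (\<not> b, x) = - ?p"
      by (simp add: signed_gpow_def p)
    then have eq: "chain_prod m ws = (?p + ?u - ?p - ?u) + chain_prod m (us @ ts)"
      unfolding Cons vs
      by (simp add: chain_prod_append chain_prod_Cons group_word_simps del: add_uminus_conv_diff)
    show ?thesis
      unfolding eq
      using mixed_comm_add[OF _ IH(1)] cl_add[OF _ IH(1)] gen comm_gens_subset_mixed_comm
        cl_comm_gens[OF gen] IH(2) Cons vs by fastforce
  qed simp
qed

lemma chain_bounds_add:
  assumes "(c, s) \<in> chain_bounds" "(d, t) \<in> chain_bounds"
  shows "(c + d, s + t) \<in> chain_bounds"
proof -
  obtain us K where us: "c = chain_coef us" "snd ` set us \<subseteq> N"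
    "\<And>m. chain_prod m us \<in> mixed_comm N" "\<And>m. real (cl N (chain_prod m us)) \<le> K + s * real m"
    using assms(1) unfolding chain_bounds_def by blast
  obtain vs J where vs: "d = chain_coef vs" "snd ` set vs \<subseteq> N"
    "\<And>m. chain_prod m vs \<in> mixed_comm N" "\<And>m. real (cl N (chain_prod m vs)) \<le> J + t * real m"
    using assms(2) unfolding chain_bounds_def by blast
  show ?thesis
    unfolding us(1) vs(1) chain_coef_append[symmetric]
  proof (rule chain_boundsI)
    show "snd ` set (us @ vs) \<subseteq> N"
      using us vs by auto
    show "chain_prod m (us @ vs) \<in> mixed_comm N" for m
      using us vs by (simp add: chain_prod_append mixed_comm_add)
    show "real (cl N (chain_prod m (us @ vs))) \<le> (K + J) + (s + t) * real m" for m
      using cl_add[OF us(3) vs(3), of m m] us(4)[of m] vs(4)[of m]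
      by (simp add: chain_prod_append algebra_simps)
  qed
qed

lemma chain_bounds_uminus:
  assumes "(c, s) \<in> chain_bounds"
  shows "(- c, s) \<in> chain_bounds"
proof -
  obtain ws K where ws: "c = chain_coef ws" "snd ` set ws \<subseteq> N"
    "\<And>m. chain_prod m ws \<in> mixed_comm N" "\<And>m. real (cl N (chain_prod m ws)) \<le> K + s * real m"
    using assms unfolding chain_bounds_def by blast
  \<comment> \<open>Reversing the list and flipping the signs inverts the product for all exponents
    at once.\<close>
  define vs where "vs = rev (map (\<lambda>(b, x). (\<not> b, x)) ws)"
  have "chain_prod m vs = - chain_prod m ws" for m
    unfolding vs_def
    by (induction ws) (auto simp: chain_prod_append chain_prod_Cons signed_gpow_def minus_add)
  moreover have "chain_coef vs = - chain_coef ws"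
    unfolding vs_def
  proof (induction ws)
    case (Cons p ws)
    obtain b x where "p = (b, x)" by (cases p)
    then show ?case
      using Cons by (simp add: chain_coef_append chain_coef_Cons[of "(b, x)" ws] chain_coef_flip fun_eq_iff)
  qed simp
  moreover have "snd ` set vs \<subseteq> N"
    using ws(2) by (auto simp: vs_def)
  ultimately show ?thesis
    using chain_boundsI[of vs K s] ws mixed_comm_uminus
      cl_uminus[OF ws(3)] by (smt (verit, best) of_nat_le_iff)
qed

text \<open>\<open>\<psi> x\<close> is the value of a Hahn-Banach extension \<open>F\<close> at the
  one-point chain \<open>\<delta> x\<close>. Each property of \<open>\<psi>\<close> is a bound for
  \<open>F\<close> at a chain whose products have zero or slow growth of commutator length. By
  \<open>abs_le_defect_scl\<close> with defect bound 1, the estimate for \<open>\<psi> y\<close> is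
  lossy by a factor of at most 2.\<close>

theorem mixed_bavard:
  assumes y: "y \<in> mixed_comm N"
  obtains \<psi> where "\<psi> \<in> inv_hom_qm N" "scl N y \<le> \<psi> y"
    "\<And>a b. a \<in> N \<Longrightarrow> b \<in> N \<Longrightarrow> \<bar>\<psi> (a + b) - \<psi> a - \<psi> b\<bar> \<le> 1"
proof -
  define \<delta> where "\<delta> x = chain_coef [(True, x)]" for x :: 'g
  have coef_True: "chain_coef ((True, x) # ws) = \<delta> x + chain_coef ws"
    and coef_False: "chain_coef ((False, x) # ws) = - \<delta> x + chain_coef ws" for x :: 'g and ws
    unfolding \<delta>_def using chain_coef_flip[of True x] by (subst chain_coef_Cons, simp)+
  have coef_replicate: "chain_coef (replicate n (False, x)) = - (of_nat n * \<delta> x)" for n and x :: 'g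
    by (induction n) (simp_all add: coef_False fun_eq_iff algebra_simps)
  have prod_replicate: "chain_prod m (replicate n (False, x)) = - gpow x (m * n)" for m n and x :: 'g
    unfolding chain_prod_def
    by (simp add: signed_gpow_def gpow_def[symmetric] gpow_uminus gpow_gpow)
  \<comment> \<open>The pairs with \<open>n > 0\<close> encode the wish
    \<open>scl N y \<le> F (\<delta> y)\<close>: they bound \<open>F (- \<delta> y)\<close> by
    \<open>- scl N y\<close>.\<close>
  define S where "S = {(c - of_nat n * \<delta> y, s - real n * scl N y) | c s n. (c, s) \<in> chain_bounds}"
  have bounds_0: "(0, 0) \<in> chain_bounds"
    using chain_boundsI[of "[]" 0 0] by simp
  have bounds_y: "(\<delta> y, real (cl N y)) \<in> chain_bounds"
    unfolding \<delta>_def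
  proof (rule chain_boundsI[where K = 0])
    show "snd ` set [(True, y)] \<subseteq> N"
      using y mixed_comm_subset by auto
    show "chain_prod m [(True, y)] \<in> mixed_comm N" for m
      using y by (simp add: chain_prod_Cons signed_gpow_def mixed_comm_gpow)
    show "real (cl N (chain_prod m [(True, y)])) \<le> 0 + real (cl N y) * real m" for m
      using cl_gpow[OF y, of m]
      by (simp add: chain_prod_Cons signed_gpow_def mult.commute flip: of_nat_mult)
  qed
  have bounds_SI: "(c, s) \<in> S" if "(c, s) \<in> chain_bounds" for c s
    unfolding S_def using that by (intro CollectI exI[of _ c] exI[of _ s] exI[of _ 0]) simp
  have "\<exists>F. (\<forall>c d. F (c + d) = F c + F d) \<and> (\<forall>c s. (c, s) \<in> S \<longrightarrow> F c \<le> s)"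
  proof (rule additive_majorized_exists[of S])
    show "(0, 0) \<in> S"
      using bounds_SI bounds_0 .
  next
    fix c d s t assume "(c, s) \<in> S" "(d, t) \<in> S"
    then obtain c' s' n d' t' k where
      cs: "c = c' - of_nat n * \<delta> y" "s = s' - real n * scl N y" "(c', s') \<in> chain_bounds" and
      dt: "d = d' - of_nat k * \<delta> y" "t = t' - real k * scl N y" "(d', t') \<in> chain_bounds"
      unfolding S_def by blast
    have "c + d = (c' + d') - of_nat (n + k) * \<delta> y"
      unfolding cs(1) dt(1) of_nat_add distrib_right by (simp add: algebra_simps)
    moreover have "s + t = (s' + t') - real (n + k) * scl N y"
      unfolding cs(2) dt(2) by (simp add: algebra_simps)
    ultimately show "(c + d, s + t) \<in> S"
      unfolding S_def using chain_bounds_add[OF cs(3) dt(3)] by blast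
  next
    fix c s assume "(c, s) \<in> S"
    then obtain d t n where d: "c = d - of_nat n * \<delta> y" "(d, t) \<in> chain_bounds"
      unfolding S_def by blast
    \<comment> \<open>Here \<open>- c\<close> is \<open>of_nat n * \<delta> y - d\<close>, so
      symmetry asks for some finite bound on each multiple of \<open>\<delta> y\<close>.\<close>
    have "\<exists>s. (of_nat k * \<delta> y, s) \<in> chain_bounds" for k
    proof (induction k)
      case 0
      show ?case
        unfolding of_nat_0 mult_zero_left using bounds_0 by blast
    next
      case (Suc k)
      then obtain s where "(of_nat k * \<delta> y, s) \<in> chain_bounds" by blast
      from chain_bounds_add[OF bounds_y this] show ?case
        unfolding of_nat_Suc distrib_right mult_1 by blast
    qed
    then obtain q where "(of_nat n * \<delta> y, q) \<in> chain_bounds" by blast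
    from chain_bounds_add[OF this chain_bounds_uminus[OF d(2)]]
    show "\<exists>t. (- c, t) \<in> S"
      using bounds_SI by (auto simp: d(1))
  next
    fix s assume "(0, s) \<in> S"
    then obtain c t n where c: "c = of_nat n * \<delta> y" "s = t - real n * scl N y" "(c, t) \<in> chain_bounds"
      unfolding S_def by auto
    then obtain ws K where ws: "c = chain_coef ws" "snd ` set ws \<subseteq> N"
      "\<And>m. chain_prod m ws \<in> mixed_comm N" "\<And>m. real (cl N (chain_prod m ws)) \<le> K + t * real m"
      unfolding chain_bounds_def by blast
    \<comment> \<open>Consistency of the wish: \<open>ws\<close> represents
      \<open>of_nat n * \<delta> y\<close>, so appending \<open>n\<close> inverse copies of
      \<open>y\<close> gives coefficient zero and a product of length bounded independently of
      \<open>m\<close>. Hence \<open>gpow y (m * n)\<close> has length at most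
      \<open>J + t * m\<close>, and letting \<open>m\<close> grow gives
      \<open>n * scl N y \<le> t\<close>.\<close>
    let ?vs = "ws @ replicate n (False, y)"
    define J where "J = K + real (length ?vs)"
    have "snd ` set ?vs \<subseteq> N" "chain_coef ?vs = 0"
      using ws(2) y mixed_comm_subset c(1) by (auto simp: chain_coef_append coef_replicate ws(1)[symmetric])
    note * = chain_coef_eq_0[OF this]
    have "real (m * n) * scl N y \<le> J + t * real m" for m
    proof -
      have "gpow y (m * n) = - chain_prod m ?vs + chain_prod m ws"
        by (simp add: chain_prod_append prod_replicate minus_add add.assoc)
      then have "cl N (gpow y (m * n)) \<le> cl N (- chain_prod m ?vs) + cl N (chain_prod m ws)"
        using cl_add[OF mixed_comm_uminus ws(3)] * by metis
      moreover have "cl N (- chain_prod m ?vs) \<le> length ?vs"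
        using cl_uminus * order_trans by blast
      ultimately show ?thesis
        using scl_mult_le[OF y, of "m * n"] ws(4)[of m] unfolding J_def by linarith
    qed
    then have "real m * (real n * scl N y - t) \<le> J" for m
      by (simp add: algebra_simps)
    then have "real n * scl N y - t \<le> 0"
      by (metis linorder_not_le reals_Archimedean3)
    then show "0 \<le> s" by (simp add: c(2))
  qed blast
  then obtain F where F_add: "\<And>c d. F (c + d) = F c + F d" and F_le: "\<And>c s. (c, s) \<in> S \<Longrightarrow> F c \<le> s"
    by blast
  have F_0: "F 0 = 0"
    using F_add[of 0 0] by simp
  have F_uminus: "F (- c) = - F c" for c
    using F_add[of c "- c"] F_0 by simp
  have F_diff: "F (c - d) = F c - F d" for c d
    using F_add[of c "- d"] F_uminus by simp
  have F_of_nat: "F (of_nat n * c) = real n * F c" for n c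
  proof (induction n)
    case (Suc n)
    then show ?case
      unfolding of_nat_Suc distrib_right mult_1 F_add by (simp only:)
  qed (simp add: F_0 flip: zero_fun_def)
  have F_bound: "\<bar>F (chain_coef ws)\<bar> \<le> s"
    if "snd ` set ws \<subseteq> N" "\<And>m. chain_prod m ws \<in> mixed_comm N"
      "\<And>m. real (cl N (chain_prod m ws)) \<le> K + s * real m" for ws s K
  proof -
    have *: "(chain_coef ws, s) \<in> chain_bounds"
      using that by (rule chain_boundsI)
    have "F (chain_coef ws) \<le> s" "F (- chain_coef ws) \<le> s"
      using F_le[OF bounds_SI] * chain_bounds_uminus[OF *] by auto
    then show ?thesis using F_uminus by simp
  qed
  have "(- \<delta> y, - scl N y) \<in> S"
    unfolding S_def using bounds_0
    by (intro CollectI exI[of _ 0] exI[of _ "0::real"] exI[of _ "1::nat"]) simp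
  then have F_y: "scl N y \<le> F (\<delta> y)"
    using F_le F_uminus by fastforce
  define \<psi> where "\<psi> x = (if x \<in> N then F (\<delta> x) else 0)" for x
  have defect: "\<bar>\<psi> (a + b) - \<psi> a - \<psi> b\<bar> \<le> 1" if ab: "a \<in> N" "b \<in> N" for a b
  proof -
    let ?ws = "[(True, a), (True, b), (False, a + b)]"
    \<comment> \<open>Raising the exponent by one inserts a single generator, the conjugate by
      \<open>gpow a m\<close> of the commutator of \<open>a\<close> and \<open>gpow b m\<close>. The
      growth rate is thus at most 1, which is the defect bound.\<close>
    have "gpow a m + gpow b m - gpow (a + b) m \<in> mixed_comm N \<and>
      cl N (gpow a m + gpow b m - gpow (a + b) m) \<le> m" for m
    proof (induction m)
      case (Suc m)
      let ?A = "gpow a m" and ?B = "gpow b m"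
      have gen: "?A + (a + ?B - a - ?B) - ?A \<in> comm_gens N"
        using ab by (intro comm_gens_conj commutator_mem_comm_gens)
      have "gpow a (Suc m) + gpow b (Suc m) - gpow (a + b) (Suc m)
          = (?A + (a + ?B - a - ?B) - ?A) + (?A + ?B - gpow (a + b) m)"
        unfolding gpow_Suc2
        by (simp add: group_word_simps del: add_uminus_conv_diff)
      then show ?case
        using mixed_comm_add[of _ N "?A + ?B - gpow (a + b) m"] cl_add[of _ N "?A + ?B - gpow (a + b) m"]
          Suc gen comm_gens_subset_mixed_comm cl_comm_gens[OF gen] by fastforce
    qed simp
    then have "\<bar>F (chain_coef ?ws)\<bar> \<le> 1"
      using ab add_mem
      by (intro F_bound[where K = 0])
         (auto simp: chain_prod_Cons signed_gpow_def group_word_simps simp del: add_uminus_conv_diff)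
    moreover have "F (chain_coef ?ws) = F (\<delta> a) + F (\<delta> b) - F (\<delta> (a + b))"
      by (simp add: coef_True coef_False F_add F_uminus F_diff)
    moreover have "\<psi> (a + b) = F (\<delta> (a + b))" "\<psi> a = F (\<delta> a)" "\<psi> b = F (\<delta> b)"
      using ab add_mem by (simp_all add: \<psi>_def)
    ultimately show ?thesis by linarith
  qed
  have conj: "\<psi> (g + x - g) = \<psi> x" if x: "x \<in> N" for g x
  proof -
    \<comment> \<open>The chain of \<open>g + x - g\<close> minus \<open>x\<close> has as its
      product one generator for every \<open>m\<close>, hence rate 0. The chains used below for
      powers and inverses even have product 0.\<close>
    have gen: "g + gpow x m - g - gpow x m \<in> comm_gens N" for m
      using x gpow_mem commutator_mem_comm_gens by blast
    have "chain_prod m [(True, g + x - g), (False, x)] = g + gpow x m - g - gpow x m" for m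
      by (simp add: chain_prod_Cons signed_gpow_def gpow_conj)
    then have "\<bar>F (chain_coef [(True, g + x - g), (False, x)])\<bar> \<le> 0"
      using x conj_mem subsetD[OF comm_gens_subset_mixed_comm gen] cl_comm_gens[OF gen]
      by (intro F_bound[where K = 1]) auto
    then show ?thesis
      using x conj_mem by (simp add: \<psi>_def coef_True coef_False F_add F_uminus F_diff)
  qed
  have pow: "\<psi> (gpow x n) = real n * \<psi> x" if x: "x \<in> N" for x n
  proof -
    let ?ws = "(True, gpow x n) # replicate n (False, x)"
    have "chain_prod m ?ws = 0" for m
      by (subst chain_prod_Cons) (simp add: prod_replicate signed_gpow_def gpow_gpow mult.commute)
    then have "\<bar>F (chain_coef ?ws)\<bar> \<le> 0"
      using x gpow_mem by (intro F_bound[where K = 0]) auto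
    then show ?thesis
      using x gpow_mem by (simp add: \<psi>_def coef_True coef_replicate F_add F_uminus F_diff F_of_nat)
  qed
  have minus: "\<psi> (- x) = - \<psi> x" if x: "x \<in> N" for x
  proof -
    have "\<bar>F (chain_coef [(True, - x), (True, x)])\<bar> \<le> 0"
      using x uminus_mem
      by (intro F_bound[where K = 0]) (auto simp: chain_prod_Cons signed_gpow_def gpow_uminus)
    then show ?thesis
      using x uminus_mem by (simp add: \<psi>_def coef_True F_add)
  qed
  have "\<psi> x = 0" if "x \<notin> N" for x
    using that by (simp add: \<psi>_def)
  then have "\<psi> \<in> inv_hom_qm N"
    unfolding inv_hom_qm_def hom_qm_def using defect conj pow minus by blast
  moreover have "scl N y \<le> \<psi> y"
    using F_y y mixed_comm_subset by (auto simp: \<psi>_def)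
  ultimately show thesis
    using that defect by blast
qed
end

section \<open>Uniform boundedness\<close>

text \<open>A generalized limit defined on all real sequences. The second property makes it agree
  with the ordinary limit wherever that exists.\<close>

lemma additive_limit_exists:
  obtains \<Lambda> :: "(nat \<Rightarrow> real) \<Rightarrow> real"
  where "\<And>f g. \<Lambda> (\<lambda>k. f k + g k) = \<Lambda> f + \<Lambda> g"
    and "\<And>f a b. eventually (\<lambda>k. a \<le> f k \<and> f k \<le> b) sequentially \<Longrightarrow> a \<le> \<Lambda> f \<and> \<Lambda> f \<le> b"
proof -
  \<comment> \<open>The eventual lower bound \<open>a\<close> is carried along because it becomes
    the upper bound of \<open>- f\<close> that symmetry demands.\<close>
  define S :: "((nat \<Rightarrow> real) \<times> real) set"
    where "S = {(f, b) | f a b. eventually (\<lambda>k. a \<le> f k \<and> f k \<le> b) sequentially}"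
  have "\<exists>F. (\<forall>c d. F (c + d) = F c + F d) \<and> (\<forall>c s. (c, s) \<in> S \<longrightarrow> F c \<le> s)"
  proof (rule additive_majorized_exists[of S])
    show "(0, 0) \<in> S"
      unfolding S_def by (auto intro: exI[of _ 0])
  next
    fix f g b d assume "(f, b) \<in> S" "(g, d) \<in> S"
    then obtain a c where "eventually (\<lambda>k. a \<le> f k \<and> f k \<le> b) sequentially"
      "eventually (\<lambda>k. c \<le> g k \<and> g k \<le> d) sequentially"
      unfolding S_def by blast
    then have "eventually (\<lambda>k. a + c \<le> (f + g) k \<and> (f + g) k \<le> b + d) sequentially"
      by eventually_elim auto
    then show "(f + g, b + d) \<in> S"
      unfolding S_def by blast
  next
    fix f b assume "(f, b) \<in> S"
    then obtain a where "eventually (\<lambda>k. a \<le> f k \<and> f k \<le> b) sequentially"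
      unfolding S_def by blast
    then have "eventually (\<lambda>k. - b \<le> (- f) k \<and> (- f) k \<le> - a) sequentially"
      by eventually_elim auto
    then show "\<exists>t. (- f, t) \<in> S"
      unfolding S_def by blast
  next
    fix s assume "(0 :: nat \<Rightarrow> real, s) \<in> S"
    then have "eventually (\<lambda>k. 0 \<le> s) sequentially"
      unfolding S_def by (auto elim: eventually_mono)
    then show "0 \<le> s" by simp
  qed blast
  then obtain F where F_add: "\<And>c d. F (c + d) = F c + F d" and F_le: "\<And>c s. (c, s) \<in> S \<Longrightarrow> F c \<le> s"
    by blast
  show thesis
  proof
    show "F (\<lambda>k. f k + g k) = F f + F g" for f g
      using F_add[of f g] by (simp add: plus_fun_def)
    show "a \<le> F f \<and> F f \<le> b" if *: "eventually (\<lambda>k. a \<le> f k \<and> f k \<le> b) sequentially" for f a b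
    proof -
      have "eventually (\<lambda>k. - b \<le> (- f) k \<and> (- f) k \<le> - a) sequentially"
        using * by eventually_elim auto
      then have "F (- f) \<le> - a" "F f \<le> b"
        using * unfolding S_def by (blast intro: F_le[unfolded S_def])+
      moreover have "F f + F (- f) = F 0" "F 0 + F 0 = F 0"
        using F_add[of f "- f"] F_add[of 0 0] by simp_all
      ultimately show ?thesis by linarith
    qed
  qed
qed

text \<open>The linear conditions on an invariant homogeneous quasimorphism pass through the
  additive functional \<open>\<Lambda>\<close>, the uniform defect bound through its squeeze
  property. Intervals that eventually contain \<open>\<psi> k x\<close> take the place of
  convergence.\<close>

lemma inv_hom_qm_limit:
  assumes \<psi>: "\<And>k. \<psi> k \<in> inv_hom_qm N"
    and D: "\<And>k a b. a \<in> N \<Longrightarrow> b \<in> N \<Longrightarrow> \<bar>\<psi> k (a + b) - \<psi> k a - \<psi> k b\<bar> \<le> D"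
  shows "\<exists>\<phi>\<in>inv_hom_qm N. \<forall>x a b.
    eventually (\<lambda>k. a \<le> \<psi> k x \<and> \<psi> k x \<le> b) sequentially \<longrightarrow> a \<le> \<phi> x \<and> \<phi> x \<le> b"
proof -
  obtain \<Lambda> :: "(nat \<Rightarrow> real) \<Rightarrow> real"
    where add: "\<And>f g. \<Lambda> (\<lambda>k. f k + g k) = \<Lambda> f + \<Lambda> g"
      and squeeze: "\<And>f a b. eventually (\<lambda>k. a \<le> f k \<and> f k \<le> b) sequentially \<Longrightarrow> a \<le> \<Lambda> f \<and> \<Lambda> f \<le> b"
    using additive_limit_exists by metis
  define \<phi> where "\<phi> x = \<Lambda> (\<lambda>k. \<psi> k x)" for x
  have zero: "\<Lambda> (\<lambda>k. 0) = 0"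
    using add[of "\<lambda>k. 0" "\<lambda>k. 0"] by simp
  have minus: "\<Lambda> (\<lambda>k. - f k) = - \<Lambda> f" for f
    using add[of f "\<lambda>k. - f k"] zero by simp
  have diff: "\<Lambda> (\<lambda>k. f k - g k) = \<Lambda> f - \<Lambda> g" for f g
    using add[of f "\<lambda>k. - g k"] minus by simp
  have mult: "\<Lambda> (\<lambda>k. real n * f k) = real n * \<Lambda> f" for f n
    by (induction n) (simp_all add: zero add distrib_right)
  have "\<bar>\<phi> (a + b) - \<phi> a - \<phi> b\<bar> \<le> D" if "a \<in> N" "b \<in> N" for a b
  proof -
    have "- D \<le> \<Lambda> (\<lambda>k. \<psi> k (a + b) - \<psi> k a - \<psi> k b) \<and> \<Lambda> (\<lambda>k. \<psi> k (a + b) - \<psi> k a - \<psi> k b) \<le> D"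
    proof (rule squeeze, rule always_eventually, rule allI)
      show "- D \<le> \<psi> k (a + b) - \<psi> k a - \<psi> k b \<and> \<psi> k (a + b) - \<psi> k a - \<psi> k b \<le> D" for k
        using D[OF that, of k] by linarith
    qed
    then show ?thesis
      by (simp add: diff \<phi>_def abs_le_iff)
  qed
  moreover have "\<phi> x = 0" if "x \<notin> N" for x
    using \<psi> that by (simp add: \<phi>_def inv_hom_qm_def hom_qm_def zero)
  moreover have "\<phi> (gpow x n) = real n * \<phi> x" "\<phi> (- x) = - \<phi> x" "\<phi> (g + x - g) = \<phi> x" if "x \<in> N" for x n g
    using \<psi> that by (simp_all add: \<phi>_def inv_hom_qm_def hom_qm_def mult minus)
  ultimately have "\<phi> \<in> inv_hom_qm N"
    unfolding inv_hom_qm_def hom_qm_def by blast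
  then show ?thesis
  proof (intro bexI[of _ \<phi>] allI impI)
    show "a \<le> \<phi> x \<and> \<phi> x \<le> b" if "eventually (\<lambda>k. a \<le> \<psi> k x \<and> \<psi> k x \<le> b) sequentially" for x a b
      unfolding \<phi>_def using that by (rule squeeze)
  qed
qed

context normal
begin

text \<open>Uniform boundedness by a gliding hump: if every constant failed, points
  \<open>y n\<close> violating the bound and quasimorphisms \<open>\<psi> n\<close> norming them
  could be combined, with suitable signs and geometric weights, into one \<open>\<phi>\<close> that
  violates the pointwise bound.\<close>

lemma scl_uniform_bound:
  assumes w: "\<And>y. y \<in> mixed_comm N \<Longrightarrow> 0 \<le> w y"
    and pointwise: "\<And>\<psi>. \<psi> \<in> inv_hom_qm N \<Longrightarrow> \<exists>M. \<forall>y\<in>mixed_comm N. \<bar>\<psi> y\<bar> \<le> M * w y"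
  shows "\<exists>C. \<forall>y\<in>mixed_comm N. scl N y \<le> C * w y"
proof (rule ccontr)
  assume contra: "\<nexists>C. \<forall>y\<in>mixed_comm N. scl N y \<le> C * w y"
  \<comment> \<open>The violation \<open>10 ^ n\<close> outweighs the later weights
    \<open>1 / 5 ^ n\<close> and leaves a factor \<open>2 ^ n\<close>.\<close>
  have "\<exists>y \<psi>. y \<in> mixed_comm N \<and> 10 ^ n * w y < scl N y \<and> \<psi> \<in> inv_hom_qm N \<and> scl N y \<le> \<psi> y
      \<and> (\<forall>a\<in>N. \<forall>b\<in>N. \<bar>\<psi> (a + b) - \<psi> a - \<psi> b\<bar> \<le> 1)" for n :: nat
  proof -
    obtain y where y: "y \<in> mixed_comm N" "10 ^ n * w y < scl N y"
      using contra by (meson linorder_not_le)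
    then show ?thesis
      using mixed_bavard[OF y(1)] by metis
  qed
  then obtain y \<psi> where y: "\<And>n. y n \<in> mixed_comm N" and yw: "\<And>n. 10 ^ n * w (y n) < scl N (y n)"
    and \<psi>: "\<And>n. \<psi> n \<in> inv_hom_qm N" and \<psi>y: "\<And>n. scl N (y n) \<le> \<psi> n (y n)"
    and \<psi>_defect: "\<And>n a b. a \<in> N \<Longrightarrow> b \<in> N \<Longrightarrow> \<bar>\<psi> n (a + b) - \<psi> n a - \<psi> n b\<bar> \<le> 1"
    by metis
  define r :: real where "r = 1 / 5"
  \<comment> \<open>With the sign \<open>sg\<close> the \<open>n\<close>th partial sum is at least \<open>r ^ n * \<psi> n (y n)\<close> in absolute value at \<open>y n\<close>;
    with ratio 1/5 the later summands change that value by at most half of \<open>r ^ n * scl N (y n)\<close>.\<close>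
  define sg where "sg n T = (if \<bar>T (y n) + r ^ n * \<psi> n (y n)\<bar> \<ge> r ^ n * \<psi> n (y n) then 1 else - 1 :: real)"
    for n T
  define S where "S = rec_nat (\<lambda>x. 0) (\<lambda>n T x. T x + sg n T * r ^ n * \<psi> n x)"
  have S_0: "S 0 = (\<lambda>x. 0)" and S_Suc: "S (Suc n) = (\<lambda>x. S n x + sg n (S n) * r ^ n * \<psi> n x)" for n
    by (simp_all add: S_def)
  have sg_abs: "\<bar>sg n T\<bar> = 1" for n T
    by (simp add: sg_def)
  have r_pos: "0 < r ^ n" for n
    by (simp add: r_def)
  have S: "S n \<in> inv_hom_qm N" for n
  proof (induction n)
    case 0
    then show ?case by (auto simp: S_0 inv_hom_qm_def hom_qm_def intro: exI[of _ 0])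
  next
    case (Suc n)
    then show ?case unfolding S_Suc using \<psi> by (rule inv_hom_qm_add_scaled)
  qed
  \<comment> \<open>Each summand has defect at most \<open>r ^ n\<close>; the constant 5/4 is the
    full geometric sum \<open>1 / (1 - r)\<close>.\<close>
  have S_defect: "\<bar>S n (a + b) - S n a - S n b\<bar> \<le> 5 / 4 * (1 - r ^ n)" if "a \<in> N" "b \<in> N" for n a b
  proof (induction n)
    case (Suc n)
    have "S (Suc n) (a + b) - S (Suc n) a - S (Suc n) b = (S n (a + b) - S n a - S n b)
        + sg n (S n) * r ^ n * (\<psi> n (a + b) - \<psi> n a - \<psi> n b)"
      by (simp add: S_Suc algebra_simps)
    moreover have "\<bar>sg n (S n) * r ^ n * (\<psi> n (a + b) - \<psi> n a - \<psi> n b)\<bar> \<le> r ^ n"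
      using \<psi>_defect[OF that, of n] r_pos[of n] by (simp add: abs_mult sg_abs)
    moreover have "5 / 4 * (1 - r ^ Suc n) = 5 / 4 * (1 - r ^ n) + r ^ n"
      by (simp add: r_def field_simps)
    ultimately show ?case
      using Suc by linarith
  qed (simp add: S_0)
  have bound: "\<bar>S n (a + b) - S n a - S n b\<bar> \<le> 5 / 4" if "a \<in> N" "b \<in> N" for n a b
    using S_defect[OF that, of n] r_pos[of n] by simp
  obtain \<phi> where \<phi>: "\<phi> \<in> inv_hom_qm N"
    and squeeze: "\<And>x a b. eventually (\<lambda>k. a \<le> S k x \<and> S k x \<le> b) sequentially \<Longrightarrow> a \<le> \<phi> x \<and> \<phi> x \<le> b"
    using inv_hom_qm_limit[where \<psi> = S, OF S bound] by blast
  have large: "r ^ n * scl N (y n) \<le> \<bar>S (Suc n) (y n)\<bar>" for n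
  proof -
    have "r ^ n * scl N (y n) \<le> r ^ n * \<psi> n (y n)"
      using \<psi>y r_pos by (simp add: mult_left_mono)
    moreover have "0 \<le> r ^ n * \<psi> n (y n)"
      using \<psi>y[of n] scl_nonneg[OF y, of n] r_pos[of n] by simp
    moreover have "S (Suc n) (y n) = (if \<bar>S n (y n) + r ^ n * \<psi> n (y n)\<bar> \<ge> r ^ n * \<psi> n (y n)
        then S n (y n) + r ^ n * \<psi> n (y n) else S n (y n) - r ^ n * \<psi> n (y n))"
      by (simp add: S_Suc sg_def)
    ultimately show ?thesis by (smt (verit))
  qed
  \<comment> \<open>The easy half of duality bounds the summand of index \<open>k\<close> at
    \<open>y n\<close> by \<open>2 * r ^ k * scl N (y n)\<close>. The right-hand side is the exact
    geometric sum of these bounds, so the induction closes.\<close>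
  have tail: "\<bar>S (Suc n + j) (y n) - S (Suc n) (y n)\<bar> \<le> scl N (y n) * (r ^ n - r ^ (n + j)) / 2" for n j
  proof (induction j)
    case (Suc j)
    have "\<bar>\<psi> (Suc n + j) (y n)\<bar> \<le> 2 * scl N (y n)"
      using abs_le_defect_scl[OF \<psi> \<psi>_defect y] by simp
    then have "\<bar>sg (Suc n + j) (S (Suc n + j)) * r ^ (Suc n + j) * \<psi> (Suc n + j) (y n)\<bar>
        \<le> r ^ (Suc n + j) * (2 * scl N (y n))"
      unfolding abs_mult sg_abs mult_1 abs_of_pos[OF r_pos]
      by (intro mult_left_mono less_imp_le[OF r_pos])
    moreover have "r ^ (Suc n + j) * (2 * scl N (y n))
        = scl N (y n) * (r ^ n - r ^ (n + Suc j)) / 2 - scl N (y n) * (r ^ n - r ^ (n + j)) / 2"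
      by (simp add: r_def algebra_simps diff_divide_distrib)
    moreover have "S (Suc n + Suc j) (y n) = S (Suc n + j) (y n)
        + sg (Suc n + j) (S (Suc n + j)) * r ^ (Suc n + j) * \<psi> (Suc n + j) (y n)"
      by (simp add: S_Suc)
    ultimately show ?case
      using Suc by linarith
  qed simp
  have lower: "r ^ n * scl N (y n) / 2 \<le> \<bar>\<phi> (y n)\<bar>" for n
  proof -
    let ?e = "r ^ n * scl N (y n) / 2" and ?t = "S (Suc n) (y n)"
    \<comment> \<open>All later partial sums stay within \<open>?e\<close> of \<open>?t\<close>, so
      the squeeze property places \<open>\<phi> (y n)\<close> there too, while
      \<open>\<bar>?t\<bar>\<close> is at least \<open>2 * ?e\<close>.\<close>
    have "?t - ?e \<le> S k (y n) \<and> S k (y n) \<le> ?t + ?e" if "Suc n \<le> k" for k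
    proof -
      obtain j where k: "k = Suc n + j"
        using le_Suc_ex[OF \<open>Suc n \<le> k\<close>] by blast
      have "0 \<le> scl N (y n) * r ^ (n + j)"
        by (intro mult_nonneg_nonneg less_imp_le[OF r_pos] scl_nonneg[OF y])
      then have "scl N (y n) * (r ^ n - r ^ (n + j)) / 2 \<le> ?e"
        by (simp add: algebra_simps)
      then show ?thesis
        unfolding k using tail[of n j] by linarith
    qed
    then have "\<forall>\<^sub>F k in sequentially. ?t - ?e \<le> S k (y n) \<and> S k (y n) \<le> ?t + ?e"
      by (rule eventually_sequentiallyI)
    from squeeze[OF this] large[of n] show ?thesis
      by linarith
  qed
  obtain M where M: "\<And>y. y \<in> mixed_comm N \<Longrightarrow> \<bar>\<phi> y\<bar> \<le> M * w y"
    using pointwise[OF \<phi>] by blast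
  obtain n where n: "2 * M < 2 ^ n"
    using real_arch_pow[of 2 "2 * M"] by auto
  \<comment> \<open>Since \<open>r * 10 = 2\<close>, this chain contradicts the choice of
    \<open>n\<close>. Its strict step comes from the violated bound, so \<open>w (y n) = 0\<close>
    is covered as well.\<close>
  have "2 ^ n * w (y n) = r ^ n * (10 ^ n * w (y n))"
    by (simp add: r_def power_one_over field_simps flip: power_mult_distrib)
  also have "\<dots> < r ^ n * scl N (y n)"
    using yw r_pos by simp
  also have "\<dots> \<le> 2 * M * w (y n)"
    using lower[of n] M[OF y, of n] by linarith
  also have "\<dots> \<le> 2 ^ n * w (y n)"
    using n w[OF y, of n] by (intro mult_right_mono) auto
  finally show False by simp
qed

end

text \<open>Invariance makes a homomorphism vanish on every commutator with an entry in
  \<open>N\<close>. Hence the homomorphism part of the denominator of W(G,L,N) is invisible on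
  \<open>[G,N]\<close>.\<close>

lemma inv_hom_eq_0_on_mixed_comm:
  assumes "h \<in> inv_hom N" "normal_subgroup N" "y \<in> mixed_comm N"
  shows "h y = 0"
proof -
  interpret normal N by standard (fact assms(2))
  have add: "h (a + b) = h a + h b" and inv: "h (g + a - g) = h a" if "a \<in> N" "b \<in> N" for a b g
    using assms(1) that unfolding inv_hom_def by auto
  have zero: "h 0 = 0"
    using add[OF zero_mem zero_mem] by simp
  have minus: "h (- a) = - h a" if "a \<in> N" for a
    using add[OF that uminus_mem[OF that]] zero by simp
  have gen: "h s = 0" if s: "s \<in> comm_gens N" for s
  proof -
    have comm: "h (commutator g x) = 0" if "x \<in> N" for g x
      using add[OF conj_mem[OF that] uminus_mem[OF that], of g] inv[OF that that] minus[OF that]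
      by (simp add: commutator_def)
    moreover have "commutator g x \<in> N" if "x \<in> N" for g x
      using comm_gens_subset commutator_mem_comm_gens(1)[OF that] unfolding commutator_def by blast
    ultimately show ?thesis
      using s minus unfolding comm_gens_def by auto
  qed
  have "h (sum_list xs) = 0" if "set xs \<subseteq> comm_gens N" for xs
    using that
  proof (induction xs)
    case (Cons s xs)
    then have "sum_list xs \<in> N" "s \<in> N"
      using mixed_comm_subset comm_gens_subset unfolding mixed_comm_def by auto
    then show ?case using Cons add gen by simp
  qed (simp add: zero)
  then show ?thesis
    using assms(3) unfolding mixed_comm_def by blast
qed

section \<open>Coarse geometry of the basis map\<close>

text \<open>Expanding \<open>\<psi>\<close> in the basis modulo the denominator verifies the
  pointwise hypothesis of \<open>scl_uniform_bound\<close>: the linear combination is controlled by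
  the values of the \<open>\<nu> j\<close>, the restricted quasimorphism on \<open>L\<close> by
  \<open>scl L\<close>.\<close>

lemma scl_le_basis_scl:
  assumes L: "normal_subgroup L" and N: "normal_subgroup N" and "N \<subseteq> L" and basis: "W_basis_reps L N l \<nu>"
  obtains C where "0 < C"
    "\<And>y. y \<in> mixed_comm N \<Longrightarrow> scl N y \<le> C * ((\<Sum>j<l. \<bar>\<nu> j y\<bar>) + scl L y)"
proof -
  interpret N: normal N by standard (fact N)
  interpret L: normal L by standard (fact L)
  have sub: "mixed_comm N \<subseteq> mixed_comm L"
    using \<open>N \<subseteq> L\<close> by (rule mixed_comm_mono)
  define w where "w y = (\<Sum>j<l. \<bar>\<nu> j y\<bar>) + scl L y" for y
  have w: "0 \<le> w y" if "y \<in> mixed_comm N" for y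
    unfolding w_def using that sub scl_nonneg by (intro add_nonneg_nonneg sum_nonneg) auto
  have "\<exists>M. \<forall>y\<in>mixed_comm N. \<bar>\<psi> y\<bar> \<le> M * w y" if "\<psi> \<in> inv_hom_qm N" for \<psi>
  proof -
    have "\<forall>\<psi>\<in>inv_hom_qm N. \<exists>c. \<exists>s\<in>W_denominator L N. \<psi> = (\<lambda>x. lin_comb l c \<nu> x + s x)"
      using basis unfolding W_basis_reps_def by (elim conjE)
    from bspec[OF this that]
    obtain c s where s_mem: "s \<in> W_denominator L N" and \<psi>_s: "\<psi> = (\<lambda>x. lin_comb l c \<nu> x + s x)"
      by (elim exE bexE)
    from s_mem obtain h \<phi> where h: "h \<in> inv_hom N" and \<phi>: "\<phi> \<in> inv_hom_qm L"
      and s: "s = (\<lambda>x. h x + (if x \<in> N then \<phi> x else 0))"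
      unfolding W_denominator_def by blast
    have D: "\<bar>\<phi> (a + b) - \<phi> a - \<phi> b\<bar> \<le> defect L \<phi>" if "a \<in> L" "b \<in> L" for a b
      using \<phi> that by (intro hom_qm_le_defect) (auto simp: inv_hom_qm_def)
    have D_nonneg: "0 \<le> defect L \<phi>"
      using D[OF L.zero_mem L.zero_mem] by linarith
    \<comment> \<open>One constant dominating both every \<open>\<bar>c j\<bar>\<close> and the
      factor \<open>2 * defect L \<phi>\<close> from the easy half of duality on
      \<open>L\<close>.\<close>
    define M where "M = (\<Sum>j<l. \<bar>c j\<bar>) + 2 * defect L \<phi>"
    have "\<bar>\<psi> y\<bar> \<le> M * w y" if y: "y \<in> mixed_comm N" for y
    proof -
      have scl: "0 \<le> scl L y"
        using y sub scl_nonneg by blast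
      have "\<bar>lin_comb l c \<nu> y\<bar> \<le> (\<Sum>j<l. \<bar>c j\<bar> * \<bar>\<nu> j y\<bar>)"
        unfolding lin_comb_def by (rule order_trans[OF sum_abs]) (simp add: abs_mult)
      also have "\<dots> \<le> (\<Sum>j<l. M * \<bar>\<nu> j y\<bar>)"
      proof (intro sum_mono mult_right_mono)
        fix j assume "j \<in> {..<l}"
        then have "\<bar>c j\<bar> \<le> (\<Sum>j<l. \<bar>c j\<bar>)"
          by (intro member_le_sum) auto
        then show "\<bar>c j\<bar> \<le> M"
          using D_nonneg unfolding M_def by linarith
      qed simp
      also have "\<dots> = M * (\<Sum>j<l. \<bar>\<nu> j y\<bar>)"
        by (simp add: sum_distrib_left)
      finally have "\<bar>lin_comb l c \<nu> y\<bar> \<le> M * (\<Sum>j<l. \<bar>\<nu> j y\<bar>)" .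
      moreover have "\<bar>\<phi> y\<bar> \<le> 2 * defect L \<phi> * scl L y"
        using L.abs_le_defect_scl[OF \<phi> D] y sub by blast
      moreover have "\<dots> \<le> M * scl L y"
        unfolding M_def using scl by (intro mult_right_mono) (auto intro: sum_nonneg)
      moreover have "\<psi> y = lin_comb l c \<nu> y + \<phi> y"
        using \<psi>_s s inv_hom_eq_0_on_mixed_comm[OF h N y] y N.mixed_comm_subset by auto
      ultimately show ?thesis
        unfolding w_def by (simp add: distrib_left)
    qed
    then show ?thesis by blast
  qed
  then obtain C where C: "\<And>y. y \<in> mixed_comm N \<Longrightarrow> scl N y \<le> C * w y"
    using N.scl_uniform_bound w by blast
  show thesis
  proof
    \<comment> \<open>The maximum with 1 ensures positivity, which the division by
      \<open>2 * C\<close> later requires.\<close>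
    show "0 < max 1 C" by simp
    fix y assume y: "y \<in> mixed_comm N"
    have "C * w y \<le> max 1 C * w y"
      using w[OF y] by (intro mult_right_mono) auto
    then show "scl N y \<le> max 1 C * ((\<Sum>j<l. \<bar>\<nu> j y\<bar>) + scl L y)"
      using C[OF y] by (simp add: w_def)
  qed
qed

theorem theorem6p1:
  fixes L N :: "'g::group_add set" and l :: nat and \<nu> :: "nat \<Rightarrow> 'g \<Rightarrow> real"
  assumes "normal_subgroup L" and "normal_subgroup N" and "N \<subseteq> L"
    and "l \<ge> 1"
    and "W_basis_reps L N l \<nu>"
  shows
    \<comment> \<open>(1) pre-coarse homomorphism\<close>
    "(\<exists>C. \<forall>y\<in>mixed_comm N. \<forall>y'\<in>mixed_comm N.
        (\<Sum>j<l. \<bar>\<nu> j (y + y') - \<nu> j y - \<nu> j y'\<bar>) \<le> C)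
    \<comment> \<open>(2)\<close>
   \<and> (\<forall>y1\<in>mixed_comm N. \<forall>y2\<in>mixed_comm N.
        Phi_dist l \<nu> y1 y2 \<le> 2 * (\<Sum>j<l. defect N (\<nu> j)) * d_scl N y1 y2 + (\<Sum>j<l. defect N (\<nu> j)))
    \<comment> \<open>(3)\<close>
   \<and> (\<exists>C1 C2. C1 > 0 \<and> C2 > 0 \<and>
        (\<forall>A. A \<subseteq> mixed_comm N \<and> d_bounded (d_scl L) A \<longrightarrow>
          (\<forall>y1\<in>A. \<forall>y2\<in>A.
             Phi_dist l \<nu> y1 y2 \<ge> 2 / (C1 * C2) * d_scl N y1 y2
               - ((2 * d_diam (d_scl L) A + 1) * C1 + 1) / (C1 * C2))))
    \<comment> \<open>in particular: coarse homomorphism (controlled)\<close>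
   \<and> (\<forall>R. \<exists>S. \<forall>y1\<in>mixed_comm N. \<forall>y2\<in>mixed_comm N.
        d_scl N y1 y2 \<le> R \<longrightarrow> Phi_dist l \<nu> y1 y2 \<le> S)
    \<comment> \<open>in particular: quasi-isometric embedding on every bounded set\<close>
   \<and> (\<forall>A. A \<subseteq> mixed_comm N \<and> d_bounded (d_scl L) A \<longrightarrow>
        (\<exists>C1 C2 D1 D2. C1 > 0 \<and> C2 > 0 \<and> D1 \<ge> 0 \<and> D2 \<ge> 0 \<and>
          (\<forall>y1\<in>A. \<forall>y2\<in>A.
             C1 * d_scl N y1 y2 - D1 \<le> Phi_dist l \<nu> y1 y2
             \<and> Phi_dist l \<nu> y1 y2 \<le> C2 * d_scl N y1 y2 + D2)))"
proof -
  interpret N: normal N by standard (fact assms(2))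
  interpret L: normal L by standard (fact assms(1))
  let ?D = "\<Sum>j<l. defect N (\<nu> j)"
  have \<nu>: "\<nu> j \<in> inv_hom_qm N" if "j < l" for j
    using assms(5) that unfolding W_basis_reps_def by blast
  have D: "\<bar>\<nu> j (a + b) - \<nu> j a - \<nu> j b\<bar> \<le> defect N (\<nu> j)" if "j < l" "a \<in> N" "b \<in> N" for j a b
    using \<nu>[OF that(1)] that by (intro hom_qm_le_defect) (auto simp: inv_hom_qm_def)
  have "0 \<le> defect N (\<nu> j)" if "j < l" for j
    using D[OF that N.zero_mem N.zero_mem] by linarith
  then have D_nonneg: "0 \<le> ?D"
    by (intro sum_nonneg) auto
  have diff_mem: "- y1 + y2 \<in> mixed_comm N" if "y1 \<in> mixed_comm N" "y2 \<in> mixed_comm N" for y1 y2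
    using that by (intro mixed_comm_add mixed_comm_uminus)
  \<comment> \<open>Passing between \<open>\<nu> j (- y1 + y2)\<close> and the difference of values
    costs one defect; this produces the additive terms in both the upper and the lower
    estimate.\<close>
  have \<nu>_diff: "\<bar>\<nu> j (- y1 + y2) - (\<nu> j y2 - \<nu> j y1)\<bar> \<le> defect N (\<nu> j)"
    if "j < l" "y1 \<in> mixed_comm N" "y2 \<in> mixed_comm N" for j y1 y2
  proof -
    have "y1 \<in> N" "y2 \<in> N"
      using that N.mixed_comm_subset by auto
    moreover from this have "\<nu> j (- y1) = - \<nu> j y1"
      using \<nu>[OF that(1)] by (simp add: inv_hom_qm_def hom_qm_def)
    ultimately show ?thesis
      using D[OF that(1) N.uminus_mem, of y1 y2] by simp
  qed
  have quasi_additive: "(\<Sum>j<l. \<bar>\<nu> j (y + y') - \<nu> j y - \<nu> j y'\<bar>) \<le> ?D"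
    if "y \<in> mixed_comm N" "y' \<in> mixed_comm N" for y y'
    using that N.mixed_comm_subset by (intro sum_mono D) auto
  have upper: "Phi_dist l \<nu> y1 y2 \<le> 2 * ?D * d_scl N y1 y2 + ?D"
    if "y1 \<in> mixed_comm N" "y2 \<in> mixed_comm N" for y1 y2
  proof -
    have "\<bar>\<nu> j y1 - \<nu> j y2\<bar> \<le> 2 * defect N (\<nu> j) * d_scl N y1 y2 + defect N (\<nu> j)" if "j < l" for j
      using N.abs_le_defect_scl[OF \<nu> D diff_mem, OF that that _ _ \<open>y1 \<in> _\<close> \<open>y2 \<in> _\<close>]
        \<nu>_diff[OF that \<open>y1 \<in> _\<close> \<open>y2 \<in> _\<close>]
      unfolding d_scl_def by linarith
    then have "Phi_dist l \<nu> y1 y2 \<le> (\<Sum>j<l. 2 * defect N (\<nu> j) * d_scl N y1 y2 + defect N (\<nu> j))"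
      unfolding Phi_dist_def by (intro sum_mono) auto
    also have "\<dots> = 2 * ?D * d_scl N y1 y2 + ?D"
      by (simp add: sum.distrib sum_distrib_left sum_distrib_right)
    finally show ?thesis .
  qed
  have d_nonneg: "0 \<le> d_scl N y1 y2" if "y1 \<in> mixed_comm N" "y2 \<in> mixed_comm N" for y1 y2
    using scl_nonneg[OF diff_mem[OF that]] by (simp add: d_scl_def)
  obtain C where "0 < C" and C: "\<And>y. y \<in> mixed_comm N \<Longrightarrow> scl N y \<le> C * ((\<Sum>j<l. \<bar>\<nu> j y\<bar>) + scl L y)"
    using scl_le_basis_scl[OF assms(1,2,3,5)] by blast
  \<comment> \<open>Chosen before any bounded set, to fit the required form:
    \<open>C1 * C2 = 2 * C\<close> gives slope \<open>1 / C\<close>, while \<open>C1\<close>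
    dominates both \<open>C\<close>, the factor of the diameter, and \<open>2 * C * ?D\<close>, the
    cost of the defects.\<close>
  define C1 where "C1 = 2 * C * ?D + C"
  define C2 where "C2 = 2 * C / C1"
  have C1: "C \<le> C1" "0 < C1"
    unfolding C1_def using \<open>0 < C\<close> D_nonneg by (auto intro: add_nonneg_pos)
  have "0 < C2" and C12: "C1 * C2 = 2 * C"
    unfolding C2_def using \<open>0 < C\<close> C1 by auto
  have lower: "2 / (C1 * C2) * d_scl N y1 y2 - ((2 * d_diam (d_scl L) A + 1) * C1 + 1) / (C1 * C2)
      \<le> Phi_dist l \<nu> y1 y2"
    if A: "A \<subseteq> mixed_comm N" "d_bounded (d_scl L) A" and y: "y1 \<in> A" "y2 \<in> A" for A y1 y2
  proof -
    have ym: "y1 \<in> mixed_comm N" "y2 \<in> mixed_comm N"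
      using A y by auto
    \<comment> \<open>Boundedness of \<open>A\<close> makes the \<open>Sup\<close> in
      \<open>d_diam\<close> an actual upper bound.\<close>
    obtain B where "\<forall>a\<in>A. \<forall>b\<in>A. d_scl L a b \<le> B"
      using A(2) unfolding d_bounded_def by blast
    then have diam: "scl L (- y1 + y2) \<le> d_diam (d_scl L) A"
      unfolding d_diam_def d_scl_def[symmetric]
      by (intro cSup_upper) (use y in \<open>auto intro!: bdd_aboveI[of _ B]\<close>)
    moreover have "0 \<le> scl L (- y1 + y2)"
      using diff_mem[OF ym] mixed_comm_mono[OF assms(3)] by (intro scl_nonneg) auto
    ultimately have "C * scl L (- y1 + y2) \<le> C1 * d_diam (d_scl L) A"
      using C1 \<open>0 < C\<close> by (intro mult_mono) auto
    moreover have "\<bar>\<nu> j (- y1 + y2)\<bar> \<le> \<bar>\<nu> j y1 - \<nu> j y2\<bar> + defect N (\<nu> j)" if "j < l" for j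
      using \<nu>_diff[OF that ym] by linarith
    then have "(\<Sum>j<l. \<bar>\<nu> j (- y1 + y2)\<bar>) \<le> Phi_dist l \<nu> y1 y2 + ?D"
      unfolding Phi_dist_def sum.distrib[symmetric] by (intro sum_mono) auto
    then have "C * (\<Sum>j<l. \<bar>\<nu> j (- y1 + y2)\<bar>) \<le> C * (Phi_dist l \<nu> y1 y2 + ?D)"
      using \<open>0 < C\<close> by (intro mult_left_mono) auto
    ultimately have "d_scl N y1 y2 \<le> C * (Phi_dist l \<nu> y1 y2 + ?D) + C1 * d_diam (d_scl L) A"
      using C[OF diff_mem[OF ym]] unfolding d_scl_def by (simp add: distrib_left)
    moreover have "2 * (C * ?D) \<le> C1"
      unfolding C1_def using \<open>0 < C\<close> by simp
    ultimately have "2 * d_scl N y1 y2 \<le> 2 * C * Phi_dist l \<nu> y1 y2 + ((2 * d_diam (d_scl L) A + 1) * C1 + 1)"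
      by (simp add: algebra_simps)
    then show ?thesis
      unfolding C12 using \<open>0 < C\<close> by (simp add: field_simps)
  qed
  have controlled: "\<exists>S. \<forall>y1\<in>mixed_comm N. \<forall>y2\<in>mixed_comm N.
      d_scl N y1 y2 \<le> R \<longrightarrow> Phi_dist l \<nu> y1 y2 \<le> S" for R
  proof (intro exI ballI impI)
    fix y1 y2 assume y: "y1 \<in> mixed_comm N" "y2 \<in> mixed_comm N" "d_scl N y1 y2 \<le> R"
    have "2 * ?D * d_scl N y1 y2 \<le> 2 * ?D * R"
      using D_nonneg y(3) by (intro mult_left_mono) auto
    then show "Phi_dist l \<nu> y1 y2 \<le> 2 * ?D * R + ?D"
      using upper[OF y(1,2)] by linarith
  qed
  have embedding: "\<exists>C1 C2 D1 D2. C1 > 0 \<and> C2 > 0 \<and> D1 \<ge> 0 \<and> D2 \<ge> 0 \<and>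
      (\<forall>y1\<in>A. \<forall>y2\<in>A. C1 * d_scl N y1 y2 - D1 \<le> Phi_dist l \<nu> y1 y2
         \<and> Phi_dist l \<nu> y1 y2 \<le> C2 * d_scl N y1 y2 + D2)"
    if A: "A \<subseteq> mixed_comm N" "d_bounded (d_scl L) A" for A
  proof (intro exI conjI ballI)
    let ?E = "((2 * d_diam (d_scl L) A + 1) * C1 + 1) / (C1 * C2)"
    \<comment> \<open>The absolute value makes the additive constant nonnegative, and the summand 1
      keeps the upper slope positive even if all defects vanish.\<close>
    show "0 < 2 / (C1 * C2)" "0 < 2 * ?D + 1" "0 \<le> \<bar>?E\<bar>" "0 \<le> ?D"
      using C1 \<open>0 < C2\<close> D_nonneg by auto
    fix y1 y2 assume y: "y1 \<in> A" "y2 \<in> A"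
    show "2 / (C1 * C2) * d_scl N y1 y2 - \<bar>?E\<bar> \<le> Phi_dist l \<nu> y1 y2"
      using lower[OF A y] by linarith
    have "2 * ?D * d_scl N y1 y2 \<le> (2 * ?D + 1) * d_scl N y1 y2"
      using d_nonneg A(1) y by (intro mult_right_mono) auto
    then show "Phi_dist l \<nu> y1 y2 \<le> (2 * ?D + 1) * d_scl N y1 y2 + ?D"
      using upper A(1) y by (meson add_right_mono order_trans subsetD)
  qed
  show ?thesis
  proof (intro conjI allI)
    show "\<exists>C. \<forall>y\<in>mixed_comm N. \<forall>y'\<in>mixed_comm N. (\<Sum>j<l. \<bar>\<nu> j (y + y') - \<nu> j y - \<nu> j y'\<bar>) \<le> C"
      using quasi_additive by (intro exI ballI)
    show "\<exists>C1 C2. C1 > 0 \<and> C2 > 0 \<and>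
        (\<forall>A. A \<subseteq> mixed_comm N \<and> d_bounded (d_scl L) A \<longrightarrow>
          (\<forall>y1\<in>A. \<forall>y2\<in>A.
             Phi_dist l \<nu> y1 y2 \<ge> 2 / (C1 * C2) * d_scl N y1 y2
               - ((2 * d_diam (d_scl L) A + 1) * C1 + 1) / (C1 * C2)))"
      using C1(2) \<open>0 < C2\<close> lower by (intro exI[of _ C1] exI[of _ C2]) simp
  qed (use upper controlled embedding in simp_all)
qed

end
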